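(* Let $d=2$ and let $p_1,p_2\ge1$ be integers with $\gcd(p_1,p_2)=1$ and $p_1p_2\ge2$; consider $r=\frac12$ and the boundary conditions (BC1), (BC2), (BCp). 1. The energy functions $F^{(\mathrm{BC}i)}(\beta)$, $i\in\{1,2,p\}$, are given explicitly by $$F^{(\mathrm{BC1})}(\beta)=\log(e^{\beta}+e^{-\beta})-\log2,$$ $$F^{(\mathrm{BC2})}(\beta)=\log(e^{\beta}+e^{-\beta})-\left(\frac{2p_1p_2-1}{p_1p_2}\right)\log2,$$ $$F^{(\mathrm{BCp})}(\beta)=\log(e^{\beta}+e^{-\beta})-\left(\frac{2p_1p_2-1}{p_1p_2}\right)\log2+\sum_{\ell=1}^{\infty}\frac{(p_1p_2-1)^2}{(p_1p_2)^{\ell+1}}\log\left[1+\left(\frac{e^{\beta}-e^{-\beta}}{e^{\beta}+e^{-\beta}}\right)^{\ell}\right].$$ 2. For $i\in\{1,2,p\}$ the function $F^{(\mathrm{BC}i)}(\beta)$ is differentiable with respect to $\beta\in\mathbb R$. 3. For $i\in\{1,2,p\}$ the multiple average $\dfrac{S^{(p_1,p_2)}_{N_1\times N_2}}{N_1N_2}$ with boundary condition (BC$i$) satisfies a large deviation principle with the rate function $$I(x)=\sup_{\beta\in\mathbb R}\big(\beta x-F^{(\mathrm{BC}i)}(\beta)\big).$$ Furthermore, if $(F^{(\mathrm{BC}i)})'(\eta)=y$, then $I(y)=\eta y-F^{(\mathrm{BC}i)}(\eta)$.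
   Context: Let $\mathbb N=\{1,2,\dots\}$ and let $\mathbb P_{1/2}$ (expectation $\mathbb E_{1/2}$) be the measure under which the spins $\sigma_{\mathbf i}$, $\mathbf i\in\mathbb N^2$, are i.i.d. uniform on $\{+1,-1\}$. The multiple sum is $$S^{(p_1,p_2)}_{N_1\times N_2}=\sum_{i_1=1}^{N_1}\sum_{i_2=1}^{N_2}\sigma_{(i_1,i_2)}\,\sigma_{(p_1i_1,p_2i_2)}.$$ It involves exactly the spins at sites of $V_{N_1,N_2}=\mathcal N\cup\{(p_1i_1,p_2i_2):(i_1,i_2)\in\mathcal N\}$, where $\mathcal N=\{1,\dots,N_1\}\times\{1,\dots,N_2\}$. These sites split into disjoint chains: for each starting point $(i_1,i_2)\in\mathcal N$ with $p_1\nmid i_1$ or $p_2\nmid i_2$, the chain is $(i_1p_1^m,i_2p_2^m)$, $0\le m\le\ell$, where $\ell$ is the number of $m\ge0$ with $(i_1p_1^m,i_2p_2^m)\in\mathcal N$; its end is $(i_1p_1^\ell,i_2p_2^\ell)$. Boundary conditions (events on the spins at sites of $V_{N_1,N_2}$): - (BC1), Dirichlet type 1: $\sigma=+1$ at every boundary site of the box $\mathcal N$, i.e. at all $(i_1,i_2)\in\mathcal N$ with $i_1\in\{1,N_1\}$ or $i_2\in\{1,N_2\}$. - (BC2), Dirichlet type 2: $\sigma=+1$ at all sites except the sites $(i_1,i_2)$ with $1<i_1<N_1$ and $1<i_2<N_2$. - (BCp), periodic: along every chain the spin at its starting point equals the spin at its end. $\mathbb E_{\frac12;(\mathrm{BC}i)}$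 denotes the (unnormalized) expectation restricted to configurations satisfying (BC$i$), $\mathbb E_{\frac12;(\mathrm{BC}i)}(Y)=\mathbb E_{1/2}(Y\,\mathbf 1_{(\mathrm{BC}i)})$. The energy function is $$F^{(\mathrm{BC}i)}(\beta)=\lim_{N_1,N_2\to\infty}\frac1{N_1N_2}\log\mathbb E_{\frac12;(\mathrm{BC}i)}\left(e^{\beta S^{(p_1,p_2)}_{N_1\times N_2}}\right).$$ The large deviation principle with boundary condition (BC$i$) is for the laws of $S^{(p_1,p_2)}_{N_1\times N_2}/(N_1N_2)$ under the corresponding restricted (unnormalized) measures $A\mapsto\mathbb P_{1/2}(A\cap(\mathrm{BC}i))$, with speed $N_1N_2$. *)

theory Defs
  imports "HOL-Probability.Probability"
begin

type_synonym site = "nat \<times> nat"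

text \<open>The lattice is indexed by positive integers; spins are extensional functions on it with
  values in \<open>{1, -1}\<close>.\<close>

definition lattice :: "site set" where
  "lattice = {1..} \<times> {1..}"

definition spin_measure :: "(site \<Rightarrow> real) measure" where
  "spin_measure = Pi\<^sub>M lattice (\<lambda>_. uniform_count_measure {1, -1})"

definition box :: "nat \<Rightarrow> nat \<Rightarrow> site set" where
  "box N1 N2 = {1..N1} \<times> {1..N2}"

definition multiple_sum :: "nat \<Rightarrow> nat \<Rightarrow> nat \<Rightarrow> nat \<Rightarrow> (site \<Rightarrow> real) \<Rightarrow> real" where
  "multiple_sum p1 p2 N1 N2 \<sigma> =
     (\<Sum>i1 = 1..N1. \<Sum>i2 = 1..N2. \<sigma> (i1, i2) * \<sigma> (p1 * i1, p2 * i2))"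

definition sites :: "nat \<Rightarrow> nat \<Rightarrow> nat \<Rightarrow> nat \<Rightarrow> site set" where
  "sites p1 p2 N1 N2 = box N1 N2 \<union> (\<lambda>(i1, i2). (p1 * i1, p2 * i2)) ` box N1 N2"

definition chain_starts :: "nat \<Rightarrow> nat \<Rightarrow> nat \<Rightarrow> nat \<Rightarrow> site set" where
  "chain_starts p1 p2 N1 N2 = {(i1, i2) \<in> box N1 N2. \<not> p1 dvd i1 \<or> \<not> p2 dvd i2}"

definition chain_site :: "nat \<Rightarrow> nat \<Rightarrow> site \<Rightarrow> nat \<Rightarrow> site" where
  "chain_site p1 p2 i m = (fst i * p1 ^ m, snd i * p2 ^ m)"

text \<open>The index set below is finite for \<open>i\<close> in the box as soon as \<open>p1 * p2 \<ge> 2\<close>, so that \<open>card\<close> is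
  a genuine count.\<close>

definition chain_length :: "nat \<Rightarrow> nat \<Rightarrow> nat \<Rightarrow> nat \<Rightarrow> site \<Rightarrow> nat" where
  "chain_length p1 p2 N1 N2 i = card {m. chain_site p1 p2 i m \<in> box N1 N2}"

datatype bc = BC1 | BC2 | BCp

fun satisfies_bc :: "bc \<Rightarrow> nat \<Rightarrow> nat \<Rightarrow> nat \<Rightarrow> nat \<Rightarrow> (site \<Rightarrow> real) \<Rightarrow> bool" where
  "satisfies_bc BC1 p1 p2 N1 N2 \<sigma> \<longleftrightarrow>
     (\<forall>(i1, i2) \<in> box N1 N2. i1 \<in> {1, N1} \<or> i2 \<in> {1, N2} \<longrightarrow> \<sigma> (i1, i2) = 1)"
| "satisfies_bc BC2 p1 p2 N1 N2 \<sigma> \<longleftrightarrow>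
     (\<forall>(i1, i2) \<in> sites p1 p2 N1 N2.
        \<not> (1 < i1 \<and> i1 < N1 \<and> 1 < i2 \<and> i2 < N2) \<longrightarrow> \<sigma> (i1, i2) = 1)"
| "satisfies_bc BCp p1 p2 N1 N2 \<sigma> \<longleftrightarrow>
     (\<forall>i \<in> chain_starts p1 p2 N1 N2.
        \<sigma> i = \<sigma> (chain_site p1 p2 i (chain_length p1 p2 N1 N2 i)))"

definition bc_event :: "bc \<Rightarrow> nat \<Rightarrow> nat \<Rightarrow> nat \<Rightarrow> nat \<Rightarrow> (site \<Rightarrow> real) set" where
  "bc_event b p1 p2 N1 N2 = {\<sigma> \<in> space spin_measure. satisfies_bc b p1 p2 N1 N2 \<sigma>}"

text \<open>The expectation and the measure \<open>A \<mapsto> P (A \<inter> B)\<close> restricted to the boundary event \<open>B\<close> are not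
  normalized.\<close>

definition bc_expectation ::
    "bc \<Rightarrow> nat \<Rightarrow> nat \<Rightarrow> nat \<Rightarrow> nat \<Rightarrow> ((site \<Rightarrow> real) \<Rightarrow> real) \<Rightarrow> real" where
  "bc_expectation b p1 p2 N1 N2 Y =
     (\<integral>\<sigma>. Y \<sigma> * indicator (bc_event b p1 p2 N1 N2) \<sigma> \<partial>spin_measure)"

definition bc_measure :: "bc \<Rightarrow> nat \<Rightarrow> nat \<Rightarrow> nat \<Rightarrow> nat \<Rightarrow> (site \<Rightarrow> real) measure" where
  "bc_measure b p1 p2 N1 N2 = density spin_measure (indicator (bc_event b p1 p2 N1 N2))"

text \<open>\<open>N1\<close> and \<open>N2\<close> tend to infinity jointly and independently of each other.\<close>

abbreviation box_limit :: "(nat \<times> nat) filter" where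
  "box_limit \<equiv> sequentially \<times>\<^sub>F sequentially"

definition finite_energy :: "bc \<Rightarrow> nat \<Rightarrow> nat \<Rightarrow> real \<Rightarrow> nat \<times> nat \<Rightarrow> real" where
  "finite_energy b p1 p2 \<beta> = (\<lambda>(N1, N2).
     1 / (real N1 * real N2) *
       ln (bc_expectation b p1 p2 N1 N2 (\<lambda>\<sigma>. exp (\<beta> * multiple_sum p1 p2 N1 N2 \<sigma>))))"

definition energy_function :: "bc \<Rightarrow> nat \<Rightarrow> nat \<Rightarrow> real \<Rightarrow> real" where
  "energy_function b p1 p2 \<beta> = Lim box_limit (finite_energy b p1 p2 \<beta>)"

definition ln_ennreal :: "ennreal \<Rightarrow> ereal" where
  "ln_ennreal x =
     (if x = 0 then -\<infinity> else if x = \<infinity> then \<infinity> else ereal (ln (enn2real x)))"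

text \<open>Closedness of the level sets is lower semicontinuity; compactness (goodness) is not part of
  the definition.\<close>

definition rate_function :: "('a :: topological_space \<Rightarrow> ereal) \<Rightarrow> bool" where
  "rate_function I \<longleftrightarrow> (\<forall>x. 0 \<le> I x) \<and> (\<forall>c::real. closed {x. I x \<le> ereal c})"

definition large_deviation_principle ::
    "'i filter \<Rightarrow> ('i \<Rightarrow> real) \<Rightarrow> ('i \<Rightarrow> 'a :: topological_space measure) \<Rightarrow> ('a \<Rightarrow> ereal) \<Rightarrow> bool"
where
  "large_deviation_principle F speed \<mu> I \<longleftrightarrow>
     rate_function I \<and>
     (\<forall>C. closed C \<longrightarrow>
        Limsup F (\<lambda>n. ln_ennreal (emeasure (\<mu> n) C) / ereal (speed n)) \<le> - (INF x\<in>C. I x)) \<and>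
     (\<forall>G. open G \<longrightarrow>
        - (INF x\<in>G. I x) \<le> Liminf F (\<lambda>n. ln_ennreal (emeasure (\<mu> n) G) / ereal (speed n)))"

definition multiple_average_law :: "bc \<Rightarrow> nat \<Rightarrow> nat \<Rightarrow> nat \<times> nat \<Rightarrow> real measure" where
  "multiple_average_law b p1 p2 = (\<lambda>(N1, N2).
     distr (bc_measure b p1 p2 N1 N2) borel
       (\<lambda>\<sigma>. multiple_sum p1 p2 N1 N2 \<sigma> / (real N1 * real N2)))"

definition legendre_transform :: "(real \<Rightarrow> real) \<Rightarrow> real \<Rightarrow> ereal" where
  "legendre_transform f x = (SUP \<beta>. ereal (\<beta> * x - f \<beta>))"

end

theory Submission
  imports Defs
begin

text \<open>Along each chain the products of consecutive spins (the bonds), together with the spins at the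
  chain ends, are again independent uniform signs, and the multiple sum is the sum of the bonds
  over the box. With free boundary the expectation is therefore \<open>cosh \<beta> ^ (N1 * N2)\<close>. Fixing the
  chain ends costs a factor \<open>1 / 2\<close> per chain, and periodicity of a chain with \<open>l\<close> bonds costs
  \<open>(1 + tanh \<beta> ^ l) / 2\<close>. The spins on the boundary of the box number only \<open>O(N1 + N2)\<close>, so fixing
  them does not change the limit. Counting chains by length gives the series for the periodic case.

  The large deviation principle follows in Gaertner--Ellis fashion from the convergence of the
  energies to a differentiable function: compactness and Chernoff bounds for closed sets, tilting
  for open sets.\<close>

section \<open>Large deviations from a differentiable energy function\<close>

text \<open>Every chain has exactly one site outside the box, its end. Hence \<open>sites\<close>
  has \<open>N1 * N2\<close> plus the number of chains many elements, and the number of chains is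
  asymptotically \<open>(1 - 1 / (p1 * p2)) * N1 * N2\<close>. The normalisation contributes - ln 2
  per site: free ends (BC1) give it back for the chains, pinned ends (BC2) do not, and
  \<open>1 + (1 - 1 / (p1 * p2)) = (2 * p1 * p2 - 1) / (p1 * p2)\<close> is the coefficient of ln 2
  in the statement. In the periodic case the number of chains with l bonds is a second difference of
  the counts of the nested boxes with sides divided by powers of \<open>p1\<close> and
  \<open>p2\<close>; this produces the square in the series.

  The restricted laws are not probability measures, so the energy at 0 may be negative. The large
  deviation argument therefore never normalises: mass at most 1 is what makes the rate function
  nonnegative. The tangent inequality for the limiting energy is obtained from the lower bound on
  balls, so convexity does not have to be carried through the limit.\<close>

lemma le_mult_exp_minus: "m \<le> a * exp (- c) \<longleftrightarrow> m * exp c \<le> a" for m a c :: real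
  by (simp add: exp_minus field_simps)

lemma mult_exp_minus_le: "a * exp (- c) \<le> m \<longleftrightarrow> a \<le> m * exp c" for m a c :: real
  by (simp add: exp_minus field_simps)

text \<open>The mass is only bounded by 1, because laws restricted to a boundary event are
  unnormalised. The common support bound \<open>K\<close> stands in for exponential tightness and
  makes every exponential integrable; \<open>mgf_pos\<close> ensures that the logarithms are
  genuine.\<close>

locale exponential_laws =
  fixes F :: "'i filter" and s :: "'i \<Rightarrow> real" and \<mu> :: "'i \<Rightarrow> real measure"
    and f :: "real \<Rightarrow> real" and K :: real
  assumes nontrivial: "F \<noteq> bot"
    and speed: "filterlim s at_top F"
    and sets_law [measurable_cong]: "\<And>n. sets (\<mu> n) = sets borel"
    and finite_law: "\<And>n. finite_measure (\<mu> n)"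
    and mass_le: "\<And>n. measure (\<mu> n) (space (\<mu> n)) \<le> 1"
    and support: "\<And>n. AE x in \<mu> n. \<bar>x\<bar> \<le> K"
    and mgf_pos: "\<And>\<beta>. \<forall>\<^sub>F n in F. 0 < (\<integral>x. exp (\<beta> * s n * x) \<partial>\<mu> n)"
    and mgf_lim: "\<And>\<beta>. ((\<lambda>n. ln (\<integral>x. exp (\<beta> * s n * x) \<partial>\<mu> n) / s n) \<longlongrightarrow> f \<beta>) F"
    and diff: "\<And>\<beta>. f differentiable (at \<beta>)"
begin

abbreviation mgf :: "real \<Rightarrow> 'i \<Rightarrow> real" where
  "mgf \<beta> n \<equiv> (\<integral>x. exp (\<beta> * s n * x) \<partial>\<mu> n)"

lemma integrable_exp: "integrable (\<mu> n) (\<lambda>x. exp (a * x))"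
proof (rule finite_measure.integrable_const_bound[OF finite_law, where B = "exp (\<bar>a\<bar> * K)"])
  show "AE x in \<mu> n. norm (exp (a * x)) \<le> exp (\<bar>a\<bar> * K)"
    using support[of n]
  proof (rule AE_mp, intro AE_I2 impI)
    fix x :: real assume "\<bar>x\<bar> \<le> K"
    then have "\<bar>a\<bar> * \<bar>x\<bar> \<le> \<bar>a\<bar> * K" by (intro mult_left_mono) auto
    moreover have "a * x \<le> \<bar>a\<bar> * \<bar>x\<bar>" by (metis abs_ge_self abs_mult)
    ultimately show "norm (exp (a * x)) \<le> exp (\<bar>a\<bar> * K)" by simp
  qed
qed measurable

lemma speed_ge: "\<forall>\<^sub>F n in F. c \<le> s n"
  using speed by (simp add: filterlim_at_top)

lemma mgf_bounds:
  assumes "e > 0"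
  shows "\<forall>\<^sub>F n in F. exp (s n * (f \<beta> - e)) \<le> mgf \<beta> n \<and> mgf \<beta> n \<le> exp (s n * (f \<beta> + e))"
proof -
  have "\<forall>\<^sub>F n in F. dist (ln (mgf \<beta> n) / s n) (f \<beta>) < e"
    using mgf_lim assms by (rule tendstoD)
  then show ?thesis using mgf_pos[of \<beta>] speed_ge[of 1]
  proof eventually_elim
    case (elim n)
    have s: "0 < s n" using elim by simp
    have "f \<beta> - e \<le> ln (mgf \<beta> n) / s n" "ln (mgf \<beta> n) / s n \<le> f \<beta> + e"
      using elim(1) by (auto simp: dist_real_def)
    then have "s n * (f \<beta> - e) \<le> ln (mgf \<beta> n)" "ln (mgf \<beta> n) \<le> s n * (f \<beta> + e)"
      using s by (simp_all add: field_simps)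
    then show ?case using elim(2)
      by (metis exp_le_cancel_iff exp_ln)
  qed
qed

lemma chernoff:
  assumes "A \<in> sets borel" and "\<And>x. x \<in> A \<Longrightarrow> c \<le> a * x"
  shows "measure (\<mu> n) A * exp c \<le> (\<integral>x. exp (a * x) \<partial>\<mu> n)"
proof -
  interpret finite_measure "\<mu> n" by (rule finite_law)
  have A: "A \<in> sets (\<mu> n)" using assms(1) by (simp add: sets_law)
  have "measure (\<mu> n) A * exp c = (\<integral>x. indicator A x * exp c \<partial>\<mu> n)"
    using A by (simp add: sets.Int_space_eq2)
  also have "\<dots> \<le> (\<integral>x. exp (a * x) \<partial>\<mu> n)"
  proof (rule integral_mono)
    show "integrable (\<mu> n) (\<lambda>x. indicator A x * exp c)"
      using A by (intro integrable_mult_left integrable_real_indicator) (auto simp: emeasure_eq_measure)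
    show "indicator A x * exp c \<le> exp (a * x)" for x
      using assms(2)[of x] by (auto simp: indicator_def)
  qed (rule integrable_exp)
  finally show ?thesis .
qed

text \<open>Tilting: under the law with density proportional to \<open>exp (\<eta> s x)\<close> both tails away from
  \<open>y = f' \<eta>\<close> are exponentially small, because \<open>f (\<eta> \<plusminus> t) - f \<eta> \<minusplus> t y\<close> is \<open>o(t)\<close>.\<close>
lemma local_lower_bound:
  assumes der: "(f has_real_derivative y) (at \<eta>)" and "\<delta> > 0" and "\<epsilon> > 0"
  shows "\<forall>\<^sub>F n in F. exp (s n * (f \<eta> - \<eta> * y - \<bar>\<eta>\<bar> * \<delta> - \<epsilon>)) \<le> measure (\<mu> n) (ball y \<delta>)"
proof -
  obtain t where t: "t > 0" "f (\<eta> + t) < f \<eta> + t * y + t * \<delta> / 2"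
      "f (\<eta> - t) < f \<eta> - t * y + t * \<delta> / 2"
  proof -
    have "((\<lambda>h. (f (\<eta> + h) - f \<eta>) / h) \<longlongrightarrow> y) (at 0)"
      using der by (simp add: DERIV_def)
    then have "\<forall>\<^sub>F h in at 0. dist ((f (\<eta> + h) - f \<eta>) / h) y < \<delta> / 2"
      using \<open>\<delta> > 0\<close> by (intro tendstoD) auto
    then obtain d where d: "d > 0"
      "\<And>h. h \<noteq> 0 \<Longrightarrow> \<bar>h\<bar> < d \<Longrightarrow> \<bar>(f (\<eta> + h) - f \<eta>) / h - y\<bar> < \<delta> / 2"
      by (auto simp: eventually_at dist_real_def)
    have "\<bar>(f (\<eta> + d / 2) - f \<eta>) / (d / 2) - y\<bar> < \<delta> / 2"
      using d(1) by (intro d(2)) auto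
    then have "(f (\<eta> + d / 2) - f \<eta>) / (d / 2) < y + \<delta> / 2" by linarith
    then have 1: "f (\<eta> + d / 2) < f \<eta> + (d / 2) * y + (d / 2) * \<delta> / 2"
      using d(1) by (simp add: field_simps)
    have "\<bar>(f (\<eta> + - (d / 2)) - f \<eta>) / - (d / 2) - y\<bar> < \<delta> / 2"
      using d(1) by (intro d(2)) auto
    moreover have "f (\<eta> + - (d / 2)) - f \<eta> = - (f \<eta> - f (\<eta> - d / 2))" by simp
    ultimately have "\<bar>(f \<eta> - f (\<eta> - d / 2)) / (d / 2) - y\<bar> < \<delta> / 2"
      by (simp only: minus_divide_divide)
    then have "(f \<eta> - f (\<eta> - d / 2)) / (d / 2) > y - \<delta> / 2" by linarith
    then have 2: "f (\<eta> - d / 2) < f \<eta> - (d / 2) * y + (d / 2) * \<delta> / 2"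
      using d(1) by (simp add: field_simps)
    show thesis using that[of "d / 2"] 1 2 d(1) by simp
  qed
  \<comment> \<open>Half of the margin: each tail has exponent at most
    \<open>f \<eta> - t * \<delta> / 2 + e\<close>, which is below \<open>f \<eta> - 2 * e\<close>,
    whereas the whole integral has exponent at least \<open>f \<eta> - e\<close>. The bound by
    \<epsilon> makes the loss acceptable at the end.\<close>
  define e where "e = min \<epsilon> (t * \<delta> / 4) / 2"
  have e: "e > 0" "2 * e \<le> \<epsilon>" "2 * e \<le> t * \<delta> / 4"
    using \<open>t > 0\<close> assms by (auto simp: e_def)
  show ?thesis
    using mgf_bounds[OF e(1), of \<eta>] mgf_bounds[OF e(1), of "\<eta> + t"] mgf_bounds[OF e(1), of "\<eta> - t"]
      speed_ge[of 1] speed_ge[of "ln 3 / e"]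
  proof eventually_elim
    case (elim n)
    define b where "b = ball y \<delta>"
    interpret finite_measure "\<mu> n" by (rule finite_law)
    have s: "0 < s n" using elim by simp
    have b: "b \<in> sets (\<mu> n)" by (simp add: b_def sets_law)
    define u where "u = exp (- s n * (t * y + t * \<delta>))"
    define v where "v = exp (s n * (t * y - t * \<delta>))"
    define w where "w = exp (s n * (\<eta> * y + \<bar>\<eta>\<bar> * \<delta>))"
    have int_b: "integrable (\<mu> n) (\<lambda>x. indicator b x * w)"
      using b by (intro integrable_mult_left integrable_real_indicator) (auto simp: emeasure_eq_measure)
    \<comment> \<open>Splits the line into the ball and its two sides. Near \<open>y\<close> the
      exponential is at most \<open>w\<close>; on the right it is dominated by its tilt by
      \<open>t\<close>, on the left by its tilt by \<open>- t\<close>, where \<open>u\<close> and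
      \<open>v\<close> are chosen to give equality at \<open>y + \<delta>\<close> and
      \<open>y - \<delta>\<close>.\<close>
    have pt: "exp (\<eta> * s n * x) \<le>
        indicator b x * w + (u * exp ((\<eta> + t) * s n * x) + v * exp ((\<eta> - t) * s n * x))" for x
    proof -
      have "\<bar>y - x\<bar> < \<delta> \<or> x \<ge> y + \<delta> \<or> x \<le> y - \<delta>" by linarith
      then consider "x \<in> b" | "x \<ge> y + \<delta>" | "x \<le> y - \<delta>"
        by (auto simp: b_def dist_real_def)
      then show ?thesis
      proof cases
        case 1
        have "\<eta> * (x - y) \<le> \<bar>\<eta>\<bar> * \<bar>x - y\<bar>" by (metis abs_ge_self abs_mult)
        also have "\<dots> \<le> \<bar>\<eta>\<bar> * \<delta>"
          using 1 by (intro mult_left_mono) (auto simp: b_def dist_real_def abs_minus_commute)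
        finally have "s n * (\<eta> * x) \<le> s n * (\<eta> * y + \<bar>\<eta>\<bar> * \<delta>)"
          using s by (intro mult_left_mono) (auto simp: algebra_simps)
        then have "exp (\<eta> * s n * x) \<le> w" by (simp add: w_def ac_simps)
        then show ?thesis using 1 by (simp add: u_def v_def add_increasing2)
      next
        case 2
        have "0 \<le> s n * (t * (x - y - \<delta>))" using 2 s t by simp
        then have "exp (\<eta> * s n * x) \<le> u * exp ((\<eta> + t) * s n * x)"
          unfolding u_def exp_add[symmetric] by (simp add: algebra_simps)
        moreover have "0 \<le> indicator b x * w" "0 \<le> v * exp ((\<eta> - t) * s n * x)"
          by (simp_all add: v_def w_def)
        ultimately show ?thesis by linarith
      next
        case 3
        have "0 \<le> s n * (t * (y - \<delta> - x))" using 3 s t by simp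
        then have "exp (\<eta> * s n * x) \<le> v * exp ((\<eta> - t) * s n * x)"
          unfolding v_def exp_add[symmetric] by (simp add: algebra_simps)
        moreover have "0 \<le> indicator b x * w" "0 \<le> u * exp ((\<eta> + t) * s n * x)"
          by (simp_all add: u_def w_def)
        ultimately show ?thesis by linarith
      qed
    qed
    have "mgf \<eta> n \<le> (\<integral>x. indicator b x * w +
        (u * exp ((\<eta> + t) * s n * x) + v * exp ((\<eta> - t) * s n * x)) \<partial>\<mu> n)"
      by (intro integral_mono pt integrable_exp Bochner_Integration.integrable_add int_b
          integrable_mult_right)
    also have "\<dots> = measure (\<mu> n) b * w + (u * mgf (\<eta> + t) n + v * mgf (\<eta> - t) n)"
      using b by (subst Bochner_Integration.integral_add
          | intro integrable_exp int_b Bochner_Integration.integrable_add integrable_mult_right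
          | simp add: sets.Int_space_eq2)+
    finally have main: "mgf \<eta> n \<le> measure (\<mu> n) b * w + (u * mgf (\<eta> + t) n + v * mgf (\<eta> - t) n)" .
    have "u * mgf (\<eta> + t) n \<le> u * exp (s n * (f (\<eta> + t) + e))"
      using elim by (intro mult_left_mono) (auto simp: u_def)
    also have "\<dots> = exp (s n * (f (\<eta> + t) + e - t * y - t * \<delta>))"
      by (simp add: u_def exp_add[symmetric] algebra_simps)
    also have "\<dots> \<le> exp (s n * (f \<eta> - 2 * e))"
      using t(2) e s by (simp add: mult_left_mono)
    finally have tu: "u * mgf (\<eta> + t) n \<le> exp (s n * (f \<eta> - 2 * e))" .
    have "v * mgf (\<eta> - t) n \<le> v * exp (s n * (f (\<eta> - t) + e))"
      using elim by (intro mult_left_mono) (auto simp: v_def)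
    also have "\<dots> = exp (s n * (f (\<eta> - t) + e + t * y - t * \<delta>))"
      by (simp add: v_def exp_add[symmetric] algebra_simps)
    also have "\<dots> \<le> exp (s n * (f \<eta> - 2 * e))"
      using t(3) e s by (simp add: mult_left_mono)
    finally have tv: "v * mgf (\<eta> - t) n \<le> exp (s n * (f \<eta> - 2 * e))" .
    \<comment> \<open>The whole integral then exceeds three copies of the tail bound; the two tails
      use up two of them, and the third is left for the ball.\<close>
    have "ln 3 \<le> s n * e" using elim(5) e by (simp add: field_simps)
    then have "exp (ln 3) \<le> exp (s n * e)" by (simp only: exp_le_cancel_iff)
    then have "3 * exp (s n * (f \<eta> - 2 * e)) \<le> exp (s n * e) * exp (s n * (f \<eta> - 2 * e))"
      by simp
    also have "\<dots> = exp (s n * (f \<eta> - e))"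
      by (simp add: exp_add[symmetric] algebra_simps)
    finally have "exp (s n * (f \<eta> - 2 * e)) \<le> measure (\<mu> n) b * w"
      using main tu tv elim by linarith
    moreover have "exp (s n * (f \<eta> - \<epsilon>)) \<le> exp (s n * (f \<eta> - 2 * e))"
      using e s by simp
    ultimately have "exp (s n * (f \<eta> - \<epsilon>)) \<le> measure (\<mu> n) b * w" by linarith
    then have "exp (s n * (f \<eta> - \<epsilon>)) * exp (- (s n * (\<eta> * y + \<bar>\<eta>\<bar> * \<delta>))) \<le> measure (\<mu> n) b"
      unfolding w_def by (simp only: mult_exp_minus_le)
    then show ?case
      by (simp add: b_def exp_add[symmetric] algebra_simps)
  qed
qed

text \<open>The mass that the local lower bound finds near \<open>y\<close> already contributes
  \<open>f \<eta> + y * (\<beta> - \<eta>)\<close>, up to an arbitrarily small error, to the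
  exponent of the moment generating function at \<beta>.\<close>

lemma tangent_le:
  assumes der: "(f has_real_derivative y) (at \<eta>)"
  shows "f \<eta> + y * (\<beta> - \<eta>) \<le> f \<beta>"
proof (rule field_le_epsilon)
  fix e :: real assume "e > 0"
  \<comment> \<open>The radius of the ball costs \<delta> times the moduli of \<beta> and \<eta>,
    which must stay below \<open>e / 2\<close>; the summand 1 keeps \<open>c\<close> positive when
    both vanish.\<close>
  define c where "c = \<bar>\<beta>\<bar> + \<bar>\<eta>\<bar> + 1"
  define \<delta> where "\<delta> = e / 2 / c"
  have c: "c > 0" by (simp add: c_def)
  then have \<delta>: "\<delta> > 0" using \<open>e > 0\<close> by (simp add: \<delta>_def)
  have "(\<bar>\<beta>\<bar> + \<bar>\<eta>\<bar>) * \<delta> \<le> c * \<delta>" using \<delta> by (simp add: c_def)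
  also have "\<dots> = e / 2" using c by (simp add: \<delta>_def)
  finally have \<delta>2: "(\<bar>\<beta>\<bar> + \<bar>\<eta>\<bar>) * \<delta> \<le> e / 2" .
  have "\<forall>\<^sub>F n in F. f \<eta> + y * (\<beta> - \<eta>) - e \<le> ln (mgf \<beta> n) / s n"
    using local_lower_bound[OF der \<delta> half_gt_zero[OF \<open>e > 0\<close>]] speed_ge[of 1] mgf_pos[of \<beta>]
  proof eventually_elim
    case (elim n)
    have s: "0 < s n" using elim by simp
    have "measure (\<mu> n) (ball y \<delta>) * exp (s n * (\<beta> * y - \<bar>\<beta>\<bar> * \<delta>)) \<le> mgf \<beta> n"
    proof (rule chernoff)
      fix x assume "x \<in> ball y \<delta>"
      then have "\<bar>\<beta>\<bar> * \<bar>y - x\<bar> \<le> \<bar>\<beta>\<bar> * \<delta>" by (intro mult_left_mono) (auto simp: dist_real_def)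
      moreover have "\<beta> * (y - x) \<le> \<bar>\<beta>\<bar> * \<bar>y - x\<bar>" by (metis abs_ge_self abs_mult)
      ultimately have "s n * (\<beta> * y - \<bar>\<beta>\<bar> * \<delta>) \<le> s n * (\<beta> * x)"
        using s by (intro mult_left_mono) (auto simp: algebra_simps)
      then show "s n * (\<beta> * y - \<bar>\<beta>\<bar> * \<delta>) \<le> \<beta> * s n * x" by (simp add: ac_simps)
    qed simp
    moreover have "exp (s n * (f \<eta> - \<eta> * y - \<bar>\<eta>\<bar> * \<delta> - e / 2)) * exp (s n * (\<beta> * y - \<bar>\<beta>\<bar> * \<delta>))
        \<le> measure (\<mu> n) (ball y \<delta>) * exp (s n * (\<beta> * y - \<bar>\<beta>\<bar> * \<delta>))"
      using elim by (intro mult_right_mono) auto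
    ultimately have "exp (s n * (f \<eta> - \<eta> * y - \<bar>\<eta>\<bar> * \<delta> - e / 2) + s n * (\<beta> * y - \<bar>\<beta>\<bar> * \<delta>)) \<le> mgf \<beta> n"
      unfolding exp_add by linarith
    moreover have "s n * (f \<eta> + y * (\<beta> - \<eta>) - e)
        \<le> s n * ((f \<eta> - \<eta> * y - \<bar>\<eta>\<bar> * \<delta> - e / 2) + (\<beta> * y - \<bar>\<beta>\<bar> * \<delta>))"
      using s \<delta>2 by (intro mult_left_mono) (auto simp: algebra_simps)
    then have "s n * (f \<eta> + y * (\<beta> - \<eta>) - e)
        \<le> s n * (f \<eta> - \<eta> * y - \<bar>\<eta>\<bar> * \<delta> - e / 2) + s n * (\<beta> * y - \<bar>\<beta>\<bar> * \<delta>)"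
      by (simp only: distrib_left)
    ultimately have "exp (s n * (f \<eta> + y * (\<beta> - \<eta>) - e)) \<le> mgf \<beta> n"
      by (meson exp_le_cancel_iff order_trans)
    then have "s n * (f \<eta> + y * (\<beta> - \<eta>) - e) \<le> ln (mgf \<beta> n)"
      using elim(3) by (simp add: ln_ge_iff)
    then show ?case using s by (simp add: field_simps)
  qed
  then have "f \<eta> + y * (\<beta> - \<eta>) - e \<le> f \<beta>"
    by (rule tendsto_lowerbound[OF mgf_lim _ nontrivial])
  then show "f \<eta> + y * (\<beta> - \<eta>) \<le> f \<beta> + e" by simp
qed

text \<open>The tangent inequality says that \<eta> maximises
  \<open>\<beta> * y - f \<beta>\<close>, so the supremum is attained there.\<close>

lemma legendre_at_derivative:
  assumes der: "(f has_real_derivative y) (at \<eta>)"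
  shows "legendre_transform f y = ereal (\<eta> * y - f \<eta>)"
  unfolding legendre_transform_def
proof (rule antisym)
  show "(SUP \<beta>. ereal (\<beta> * y - f \<beta>)) \<le> ereal (\<eta> * y - f \<eta>)"
  proof (rule SUP_least)
    fix \<beta> show "ereal (\<beta> * y - f \<beta>) \<le> ereal (\<eta> * y - f \<eta>)"
      using tangent_le[OF der, of \<beta>] by (simp add: algebra_simps)
  qed
qed (rule SUP_upper, simp)

text \<open>Total mass at most 1 has nonpositive logarithm. Taking \<beta> = 0 in the supremum, this
  yields nonnegativity of the rate function.\<close>

lemma at_zero: "f 0 \<le> 0"
proof (rule tendsto_upperbound[OF mgf_lim _ nontrivial])
  show "\<forall>\<^sub>F n in F. ln (mgf 0 n) / s n \<le> 0"
    using speed_ge[of 1] mgf_pos[of 0]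
  proof eventually_elim
    case (elim n)
    then show ?case using mass_le[of n] by (auto simp: divide_le_0_iff)
  qed
qed

lemma rate_function_legendre: "rate_function (legendre_transform f)"
  unfolding rate_function_def legendre_transform_def
proof (intro conjI allI)
  fix x :: real
  have "ereal 0 \<le> ereal (0 * x - f 0)" using at_zero by simp
  also have "\<dots> \<le> (SUP \<beta>. ereal (\<beta> * x - f \<beta>))" by (rule SUP_upper) simp
  finally show "0 \<le> (SUP \<beta>. ereal (\<beta> * x - f \<beta>))" by (simp add: zero_ereal_def)
next
  fix c :: real
  have "{x. (SUP \<beta>. ereal (\<beta> * x - f \<beta>)) \<le> ereal c} = (\<Inter>\<beta>. {x. \<beta> * x - f \<beta> \<le> c})"
    by (auto simp: SUP_le_iff)
  moreover have "closed {x. \<beta> * x - f \<beta> \<le> c}" for \<beta>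
    by (intro closed_Collect_le continuous_intros)
  ultimately show "closed {x. (SUP \<beta>. ereal (\<beta> * x - f \<beta>)) \<le> ereal c}"
    by (simp add: closed_INT)
qed

section \<open>Normalised logarithms and the upper bound on closed sets\<close>

lemma ln_emeasure:
  "ln_ennreal (emeasure (\<mu> n) A) =
    (if measure (\<mu> n) A = 0 then -\<infinity> else ereal (ln (measure (\<mu> n) A)))"
proof -
  interpret finite_measure "\<mu> n" by (rule finite_law)
  show ?thesis by (auto simp: ln_ennreal_def emeasure_eq_measure)
qed

lemma normalized_ln_le:
  assumes "s n > 0" and "M > 0" and "measure (\<mu> n) A \<le> M * exp (- (s n * \<alpha>))"
  shows "ln_ennreal (emeasure (\<mu> n) A) / ereal (s n) \<le> ereal (ln M / s n - \<alpha>)"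
proof (cases "measure (\<mu> n) A = 0")
  case True
  then show ?thesis using assms(1) by (simp add: ln_emeasure)
next
  case False
  then have "measure (\<mu> n) A > 0" by (simp add: zero_less_measure_iff)
  then have "ln (measure (\<mu> n) A) \<le> ln (M * exp (- (s n * \<alpha>)))"
    using assms by (subst ln_le_cancel_iff) auto
  also have "\<dots> = ln M - s n * \<alpha>" using assms(2) by (simp add: ln_mult)
  finally have "ln (measure (\<mu> n) A) / s n \<le> ln M / s n - \<alpha>"
    using assms(1) by (simp add: field_simps)
  then show ?thesis using False assms(1) by (simp add: ln_emeasure)
qed

lemma normalized_ln_ge:
  assumes "s n > 0" and "exp (s n * c) \<le> measure (\<mu> n) A"
  shows "ereal c \<le> ln_ennreal (emeasure (\<mu> n) A) / ereal (s n)"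
proof -
  have pos: "measure (\<mu> n) A > 0" using assms(2) by (meson exp_gt_zero less_le_trans)
  then have "s n * c \<le> ln (measure (\<mu> n) A)" using assms(2) by (simp add: ln_ge_iff)
  then have "c \<le> ln (measure (\<mu> n) A) / s n" using assms(1) by (simp add: field_simps)
  then show ?thesis using pos assms(1) by (simp add: ln_emeasure)
qed

text \<open>Each point of \<open>C\<close> has a slope \<open>b x\<close> for which Chernoff's bound
  beats \<alpha> on an open half-line \<open>U x\<close> around it (or on the whole line, if the
  slope is 0). By the support bound only the compact part of \<open>C\<close> carries mass, so
  finitely many of these sets suffice.\<close>

lemma closed_upper_bound:
  assumes "closed C" and C: "\<And>x. x \<in> C \<Longrightarrow> ereal \<alpha> < legendre_transform f x"
  obtains M where "M > 0" and "\<forall>\<^sub>F n in F. measure (\<mu> n) C \<le> M * exp (- (s n * \<alpha>))"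
proof -
  have "\<exists>\<beta>. \<alpha> < \<beta> * x - f \<beta>" if "x \<in> C" for x
    using C[OF that] by (auto simp: legendre_transform_def less_SUP_iff)
  then obtain b where b: "\<And>x. x \<in> C \<Longrightarrow> \<alpha> < b x * x - f (b x)" by metis
  \<comment> \<open>Half of the gain over \<alpha>: one half pays for replacing \<open>x\<close> by
    other points of \<open>U x\<close>, the other half for the error in the moment generating
    function, and the exponent becomes exactly \<alpha>.\<close>
  define \<gamma> where "\<gamma> x = (b x * x - f (b x) - \<alpha>) / 2" for x
  define U where "U x = {u. b x * x - \<gamma> x < b x * u}" for x
  have \<gamma>: "\<gamma> x > 0" if "x \<in> C" for x using b[OF that] by (simp add: \<gamma>_def)
  have openU: "open (U x)" for x
    unfolding U_def by (intro open_Collect_less continuous_intros)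
  have "compact (C \<inter> {-K..K})" using \<open>closed C\<close> by (intro closed_Int_compact) auto
  then obtain D where D: "D \<subseteq> C" "finite D" "C \<inter> {-K..K} \<subseteq> (\<Union>x\<in>D. U x)"
  proof (rule compactE_image)
    show "C \<inter> {-K..K} \<subseteq> (\<Union>x\<in>C. U x)" using \<gamma> by (auto simp: U_def)
  qed (use openU in auto)
  have "\<forall>\<^sub>F n in F. \<forall>x\<in>D. mgf (b x) n \<le> exp (s n * (f (b x) + \<gamma> x))"
  proof (rule eventually_ball_finite[OF D(2)], rule ballI)
    fix x assume "x \<in> D"
    then have "\<gamma> x > 0" using D(1) \<gamma> by auto
    then show "\<forall>\<^sub>F n in F. mgf (b x) n \<le> exp (s n * (f (b x) + \<gamma> x))"
      by (rule eventually_mono[OF mgf_bounds[where \<beta> = "b x"]]) simp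
  qed
  \<comment> \<open>The summand 1 keeps the prefactor positive when the cover is empty.\<close>
  then have "\<forall>\<^sub>F n in F. measure (\<mu> n) C \<le> (real (card D) + 1) * exp (- (s n * \<alpha>))"
    using speed_ge[of 1]
  proof eventually_elim
    case (elim n)
    interpret finite_measure "\<mu> n" by (rule finite_law)
    have s: "s n > 0" using elim by simp
    have U_sets: "U x \<in> sets (\<mu> n)" for x by (simp add: sets_law openU)
    have U: "measure (\<mu> n) (U x) \<le> exp (- (s n * \<alpha>))" if "x \<in> D" for x
    proof -
      have "measure (\<mu> n) (U x) * exp (s n * (b x * x - \<gamma> x)) \<le> mgf (b x) n"
      proof (rule chernoff)
        fix u assume "u \<in> U x"
        then have "s n * (b x * x - \<gamma> x) \<le> s n * (b x * u)"
          using s by (intro mult_left_mono) (auto simp: U_def)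
        then show "s n * (b x * x - \<gamma> x) \<le> b x * s n * u" by (simp add: ac_simps)
      qed (simp add: openU)
      also have "\<dots> \<le> exp (s n * (f (b x) + \<gamma> x))" using elim that by auto
      finally have "measure (\<mu> n) (U x) \<le>
          exp (s n * (f (b x) + \<gamma> x)) * exp (- (s n * (b x * x - \<gamma> x)))"
        by (simp only: le_mult_exp_minus)
      also have "\<dots> = exp (- (s n * \<alpha>))"
        unfolding exp_add[symmetric] by (simp add: \<gamma>_def field_simps)
      finally show ?thesis .
    qed
    have "measure (\<mu> n) C \<le> measure (\<mu> n) (\<Union>x\<in>D. U x)"
    proof (rule finite_measure_mono_AE)
      show "AE x in \<mu> n. x \<in> C \<longrightarrow> x \<in> (\<Union>x\<in>D. U x)"
        using support[of n] by (rule AE_mp) (use D(3) in \<open>force intro!: AE_I2\<close>)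
    qed (use U_sets D(2) in auto)
    also have "\<dots> \<le> (\<Sum>x\<in>D. measure (\<mu> n) (U x))"
      using D(2) U_sets by (intro finite_measure_subadditive_finite) auto
    also have "\<dots> \<le> real (card D) * exp (- (s n * \<alpha>))"
      using U by (rule sum_bounded_above)
    also have "\<dots> \<le> (real (card D) + 1) * exp (- (s n * \<alpha>))" by simp
    finally show ?case .
  qed
  then show thesis by (intro that) auto
qed

text \<open>A point \<open>x\<close> of finite rate need not be a value of \<open>f'\<close>. Minimising \<open>f \<beta> - \<beta> x + e \<beta>\<^sup>2 / 2\<close>
  produces a slope near \<open>x\<close> at which the local lower bound is at least as good.\<close>
lemma nearby_slope:
  assumes I: "legendre_transform f x \<le> ereal i" and "r > 0"
  obtains \<eta> y where "(f has_real_derivative y) (at \<eta>)" and "dist x y < r" and "- i \<le> f \<eta> - \<eta> * y"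
proof -
  have low: "\<beta> * x - f \<beta> \<le> i" for \<beta>
    using I by (auto simp: legendre_transform_def SUP_le_iff)
  define c where "c = f 0 + i"
  \<comment> \<open>The minimiser will satisfy \<open>e * \<eta>\<^sup>2 / 2 \<le> c\<close>, hence
    \<open>(e * \<eta>)\<^sup>2 \<le> 2 * e * c\<close>; this choice of \<open>e\<close> makes the
    right-hand side smaller than \<open>r\<^sup>2\<close>.\<close>
  define e where "e = r\<^sup>2 / (2 * c + 1)"
  have c: "c \<ge> 0" using low[of 0] by (simp add: c_def)
  have e: "e > 0" using c \<open>r > 0\<close> by (simp add: e_def)
  define h where "h \<beta> = f \<beta> - \<beta> * x + e * \<beta>\<^sup>2 / 2" for \<beta>
  have f_cont: "continuous_on A f" for A
    by (intro continuous_at_imp_continuous_on ballI differentiable_imp_continuous_within diff)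
  \<comment> \<open>Outside the interval the quadratic penalty alone exceeds \<open>c\<close>, so
    \<open>h\<close> is at least \<open>f 0\<close> there and the minimum over the interval is
    global. The summand 1 gives \<open>R \<ge> 1\<close>, so that squares dominate absolute
    values.\<close>
  define R where "R = 2 * (c + 1) / e + 1"
  have R: "R \<ge> 1" using c e by (simp add: R_def)
  have "\<exists>\<eta>\<in>{-R..R}. \<forall>\<beta>\<in>{-R..R}. h \<eta> \<le> h \<beta>"
    unfolding h_def
    by (rule continuous_attains_inf) (use R in \<open>auto intro!: continuous_intros f_cont\<close>)
  then obtain \<eta> where \<eta>: "\<And>\<beta>. \<beta> \<in> {-R..R} \<Longrightarrow> h \<eta> \<le> h \<beta>" by blast
  have h0: "h \<eta> \<le> f 0" using \<eta>[of 0] R by (simp add: h_def)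
  have min: "h \<eta> \<le> h \<beta>" for \<beta>
  proof (cases "\<beta> \<in> {-R..R}")
    case False
    then have "R \<le> \<bar>\<beta>\<bar>" by auto
    then have "R * 1 \<le> \<bar>\<beta>\<bar> * \<bar>\<beta>\<bar>" using R by (intro mult_mono) auto
    then have "e * R \<le> e * \<beta>\<^sup>2" using e by (simp add: power2_eq_square)
    moreover have "e * R = 2 * (c + 1) + e" using e by (simp add: R_def field_simps)
    moreover define q where "q = e * \<beta>\<^sup>2"
    ultimately have "f 0 \<le> f \<beta> - \<beta> * x + q / 2" using low[of \<beta>] e by (simp add: c_def)
    then have "f 0 \<le> h \<beta>" by (simp add: h_def q_def)
    then show ?thesis using h0 by linarith
  qed (rule \<eta>)
  obtain y where y: "(f has_real_derivative y) (at \<eta>)"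
    using diff real_differentiable_def by blast
  have "(h has_real_derivative (y - x + e * \<eta>)) (at \<eta>)"
    unfolding h_def by (auto intro!: derivative_eq_intros y)
  then have "y - x + e * \<eta> = 0"
    by (rule DERIV_local_min[where d = 1]) (use min in auto)
  then have yx: "y = x - e * \<eta>" by simp
  have quad: "e * \<eta>\<^sup>2 / 2 \<le> c" using h0 low[of \<eta>] by (simp add: h_def c_def)
  have "(e * \<eta>)\<^sup>2 = 2 * e * (e * \<eta>\<^sup>2 / 2)" by (simp add: power2_eq_square)
  also have "\<dots> \<le> 2 * e * c" using quad e by (intro mult_left_mono) auto
  also have "\<dots> < r\<^sup>2"
  proof -
    have "r\<^sup>2 * (2 * c) < r\<^sup>2 * (2 * c + 1)"
      using \<open>r > 0\<close> by (intro mult_strict_left_mono) auto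
    then show ?thesis using c by (simp add: e_def divide_less_eq mult_ac)
  qed
  finally have "\<bar>e * \<eta>\<bar>\<^sup>2 < r\<^sup>2" by (simp only: power2_abs)
  then have "\<bar>e * \<eta>\<bar> < r" using \<open>r > 0\<close> by (rule power2_less_imp_less[OF _ less_imp_le])
  then have "dist x y < r" by (simp add: yx dist_real_def)
  \<comment> \<open>The displacement of \<open>y\<close> enters with the favourable sign:
    \<open>f \<eta> - \<eta> * y\<close> equals \<open>f \<eta> - \<eta> * x\<close> plus
    \<open>e * \<eta>\<^sup>2\<close>.\<close>
  moreover have "- i \<le> f \<eta> - \<eta> * y"
  proof -
    have "0 \<le> e * \<eta>\<^sup>2" using e by simp
    then show ?thesis using low[of \<eta>] by (simp add: yx algebra_simps power2_eq_square)
  qed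
  ultimately show thesis using y by (intro that)
qed

theorem large_deviations: "large_deviation_principle F s \<mu> (legendre_transform f)"
  unfolding large_deviation_principle_def
proof (intro conjI allI impI rate_function_legendre)
  fix C :: "real set" assume "closed C"
  define L where "L = Limsup F (\<lambda>n. ln_ennreal (emeasure (\<mu> n) C) / ereal (s n))"
  define I where "I = (INF x\<in>C. legendre_transform f x)"
  have "L \<le> - I"
  proof (rule ccontr)
    assume "\<not> L \<le> - I"
    \<comment> \<open>Two real levels in the assumed gap: the decay is proved at \<open>r1\<close>,
      and the room up to \<open>r2\<close> absorbs the prefactor \<open>M\<close> once the speed is
      large. Working with real levels also covers infinite rates.\<close>
    then obtain r2 where r2: "- I < ereal r2" "ereal r2 < L"
      using ereal_dense2 by (meson not_le)
    then obtain r1 where r1: "- I < ereal r1" "ereal r1 < ereal r2"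
      using ereal_dense2 by blast
    have "ereal (- r1) < I" using r1(1) by (cases I) auto
    then have "ereal (- r1) < legendre_transform f x" if "x \<in> C" for x
      unfolding I_def using that by (meson INF_lower less_le_trans)
    then obtain M where M: "M > 0" "\<forall>\<^sub>F n in F. measure (\<mu> n) C \<le> M * exp (- (s n * - r1))"
      using closed_upper_bound[OF \<open>closed C\<close>] by blast
    have "L \<le> ereal r2"
      unfolding L_def
    proof (rule Limsup_bounded)
      show "\<forall>\<^sub>F n in F. ln_ennreal (emeasure (\<mu> n) C) / ereal (s n) \<le> ereal r2"
        using M(2) speed_ge[of 1] speed_ge[of "ln M / (r2 - r1)"]
      proof eventually_elim
        case (elim n)
        have s: "s n > 0" using elim by simp
        have "ln M / s n - - r1 \<le> r2"
          using elim(3) r1(2) s by (simp add: field_simps)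
        then show ?case
          using normalized_ln_le[OF s M(1) elim(1)] by (metis ereal_less_eq(3) order_trans)
      qed
    qed
    then show False using r2(2) by simp
  qed
  then show "Limsup F (\<lambda>n. ln_ennreal (emeasure (\<mu> n) C) / ereal (s n))
      \<le> - (INF x\<in>C. legendre_transform f x)"
    by (simp add: L_def I_def)
next
  fix G :: "real set" assume "open G"
  define L where "L = Liminf F (\<lambda>n. ln_ennreal (emeasure (\<mu> n) G) / ereal (s n))"
  have "- L \<le> legendre_transform f x" if x: "x \<in> G" for x
  proof (rule ccontr)
    assume "\<not> ?thesis"
    then obtain i where i: "legendre_transform f x < ereal i" "ereal i < - L"
      using ereal_dense2 by (meson not_le)
    then obtain j where j: "ereal i < ereal j" "ereal j < - L"
      using ereal_dense2 by blast
    obtain r where r: "r > 0" "ball x r \<subseteq> G" using openE[OF \<open>open G\<close> x] by blast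
    obtain \<eta> y where y: "(f has_real_derivative y) (at \<eta>)" "dist x y < r" "- i \<le> f \<eta> - \<eta> * y"
      using nearby_slope[OF less_imp_le[OF i(1)] r(1)] by blast
    have "y \<in> G" using r(2) y(2) by auto
    then obtain d where d: "d > 0" "ball y d \<subseteq> G" using openE[OF \<open>open G\<close> \<open>y \<in> G\<close>] by blast
    \<comment> \<open>The gap \<open>j - i\<close> is spent in two equal parts, one on the term with
      \<delta> and one on the error of the local lower bound; \<delta> is also kept below
      \<open>d\<close>, so that the ball stays in \<open>G\<close>.\<close>
    define e where "e = (j - i) / 2"
    define \<delta> where "\<delta> = min d (e / (\<bar>\<eta>\<bar> + 1))"
    have e: "e > 0" using j(1) by (simp add: e_def)
    have \<delta>: "\<delta> > 0" using d e by (simp add: \<delta>_def add_nonneg_pos)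
    have "\<bar>\<eta>\<bar> * \<delta> \<le> (\<bar>\<eta>\<bar> + 1) * (e / (\<bar>\<eta>\<bar> + 1))"
      using \<delta> by (intro mult_mono) (auto simp: \<delta>_def)
    also have "\<dots> = e" using abs_ge_zero[of \<eta>] by (simp add: field_simps)
    finally have \<eta>\<delta>: "\<bar>\<eta>\<bar> * \<delta> \<le> e" .
    have "ereal (- j) \<le> L"
      unfolding L_def
    proof (rule Liminf_bounded)
      show "\<forall>\<^sub>F n in F. ereal (- j) \<le> ln_ennreal (emeasure (\<mu> n) G) / ereal (s n)"
        using local_lower_bound[OF y(1) \<delta> e] speed_ge[of 1]
      proof eventually_elim
        case (elim n)
        interpret finite_measure "\<mu> n" by (rule finite_law)
        have s: "s n > 0" using elim by simp
        have "- j \<le> f \<eta> - \<eta> * y - \<bar>\<eta>\<bar> * \<delta> - e" using y(3) \<eta>\<delta> by (simp add: e_def field_simps)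
        then have "exp (s n * - j) \<le> exp (s n * (f \<eta> - \<eta> * y - \<bar>\<eta>\<bar> * \<delta> - e))"
          using s by (simp only: exp_le_cancel_iff mult_le_cancel_left_pos)
        also note elim(1)
        also have "measure (\<mu> n) (ball y \<delta>) \<le> measure (\<mu> n) G"
          using d(2) \<open>open G\<close> by (intro finite_measure_mono) (auto simp: sets_law \<delta>_def)
        finally show ?case by (rule normalized_ln_ge[OF s])
      qed
    qed
    then have "- L \<le> ereal j" by (cases L) auto
    then show False using j(2) by simp
  qed
  then have "- L \<le> (INF x\<in>G. legendre_transform f x)" by (rule INF_greatest)
  then show "- (INF x\<in>G. legendre_transform f x)
      \<le> Liminf F (\<lambda>n. ln_ennreal (emeasure (\<mu> n) G) / ereal (s n))"
    unfolding L_def[symmetric] by (simp add: ereal_uminus_le_reorder)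
qed

end

section \<open>Limits along growing boxes\<close>

lemma tendsto_div_ratio:
  assumes "q \<ge> 1"
  shows "(\<lambda>N. real (N div q) / real N) \<longlonglongrightarrow> 1 / real q"
proof (rule tendsto_sandwich)
  show "\<forall>\<^sub>F N in sequentially. real (N div q) / real N \<le> 1 / real q"
    using eventually_gt_at_top[of 0]
  proof eventually_elim
    case (elim N)
    have "real (N div q) \<le> real N / real q" by (rule of_nat_div_le_of_nat)
    then show ?case using elim by (simp add: field_simps)
  qed
  show "\<forall>\<^sub>F N in sequentially. 1 / real q - 1 / real N \<le> real (N div q) / real N"
    using eventually_gt_at_top[of 0]
  proof eventually_elim
    case (elim N)
    have "N < q * (N div q) + q" using assms dividend_less_times_div[of q N] by simp
    then have "real N < real q * (real (N div q) + 1)"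
      by (metis distrib_left mult.right_neutral of_nat_1 of_nat_add of_nat_less_iff of_nat_mult)
    then have "real N / real q \<le> real (N div q) + 1" using assms by (simp add: field_simps)
    then have "real N / real q / real N \<le> (real (N div q) + 1) / real N"
      by (rule divide_right_mono) simp
    then show ?case using elim by (simp add: add_divide_distrib)
  qed
  have "(\<lambda>N. 1 / real q - 1 / real N) \<longlonglongrightarrow> 1 / real q - 0"
    by (intro tendsto_intros lim_1_over_n)
  then show "(\<lambda>N. 1 / real q - 1 / real N) \<longlonglongrightarrow> 1 / real q" by simp
qed simp

lemma box_limit_div_ratio:
  assumes "q1 \<ge> 1" and "q2 \<ge> 1"
  shows "((\<lambda>(N1, N2). real (N1 div q1) * real (N2 div q2) / (real N1 * real N2))
    \<longlongrightarrow> 1 / (real q1 * real q2)) box_limit"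
proof -
  have "((\<lambda>N. (real (fst N div q1) / real (fst N)) * (real (snd N div q2) / real (snd N)))
      \<longlongrightarrow> (1 / real q1) * (1 / real q2)) box_limit"
    by (intro tendsto_mult filterlim_compose[OF tendsto_div_ratio[OF assms(1)] filterlim_fst]
        filterlim_compose[OF tendsto_div_ratio[OF assms(2)] filterlim_snd])
  then show ?thesis by (simp add: case_prod_unfold)
qed

lemma box_limit_neq_bot: "box_limit \<noteq> bot"
  by (simp add: prod_filter_eq_bot)

lemma eventually_box_limit_pos: "\<forall>\<^sub>F N in box_limit. 0 < fst N \<and> 0 < snd N"
  using eventually_compose_filterlim[OF eventually_gt_at_top[of 0] filterlim_fst[of sequentially sequentially]]
    eventually_compose_filterlim[OF eventually_gt_at_top[of 0] filterlim_snd[of sequentially sequentially]]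
  by eventually_elim simp

text \<open>Perimeter over area: this is the size of the error made by resetting the spins on the
  boundary of the box.\<close>

lemma box_limit_boundary_ratio:
  "((\<lambda>(N1, N2). 2 * (real N1 + real N2) * c / (real N1 * real N2)) \<longlongrightarrow> 0) box_limit"
proof -
  have "((\<lambda>N. 2 * c * (1 / real (snd N) + 1 / real (fst N))) \<longlongrightarrow> 2 * c * (0 + 0)) box_limit"
    by (intro tendsto_intros filterlim_compose[OF lim_1_over_n filterlim_fst]
        filterlim_compose[OF lim_1_over_n filterlim_snd])
  moreover have "\<forall>\<^sub>F N in box_limit. 2 * c * (1 / real (snd N) + 1 / real (fst N))
      = 2 * (real (fst N) + real (snd N)) * c / (real (fst N) * real (snd N))"
    using eventually_box_limit_pos by eventually_elim (simp add: field_simps)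
  ultimately show ?thesis
    by (simp add: case_prod_unfold tendsto_cong)
qed

lemma filterlim_box_volume: "filterlim (\<lambda>(N1, N2). real N1 * real N2) at_top box_limit"
proof -
  have "filterlim (\<lambda>N. real (fst N) * real (snd N)) at_top box_limit"
    by (intro filterlim_at_top_mult_at_top
        filterlim_compose[OF filterlim_real_sequentially filterlim_fst]
        filterlim_compose[OF filterlim_real_sequentially filterlim_snd])
  then show ?thesis by (simp add: case_prod_unfold)
qed

section \<open>Regularity of the periodic series\<close>

text \<open>The singularity at -1 dictates the bound, and it also covers positive arguments because
  \<open>ln (1 + x) \<le> x \<le> - ln (1 - r)\<close>. As powers of a number below 1 in modulus
  only shrink, one constant dominates all logarithms in the periodic series.\<close>

lemma abs_ln_one_plus_le:
  fixes x r :: real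
  assumes "\<bar>x\<bar> \<le> r" and "r < 1"
  shows "\<bar>ln (1 + x)\<bar> \<le> - ln (1 - r)"
proof (cases "x \<ge> 0")
  case True
  have "ln (1 + x) \<le> x" using True by (rule ln_add_one_self_le_self)
  also have "x \<le> - ln (1 - r)"
    using ln_le_minus_one[of "1 - r"] assms by simp
  finally show ?thesis using True by simp
next
  case False
  have "ln (1 + x) \<le> 0" using False assms by (simp add: ln_le_zero_iff)
  moreover have "ln (1 - r) \<le> ln (1 + x)" using assms by (subst ln_le_cancel_iff) auto
  ultimately show ?thesis by simp
qed

text \<open>Termwise differentiation on a ball whose radius \<open>r\<close> lies midway between the
  modulus of \<open>t\<close> and 1. There \<open>1 + x ^ Suc k\<close> stays above
  \<open>1 - r\<close>, so the derivatives are dominated by the summable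
  \<open>real (Suc k) * r ^ k / (1 - r)\<close>; at 0 all terms vanish.\<close>

lemma ln_one_plus_power_series_differentiable:
  fixes w :: "nat \<Rightarrow> real"
  assumes w: "\<And>k. \<bar>w k\<bar> \<le> 1" and t: "\<bar>t\<bar> < 1"
  shows "(\<lambda>x. \<Sum>k. w k * ln (1 + x ^ Suc k)) differentiable (at t)"
proof -
  define r where "r = (1 + \<bar>t\<bar>) / 2"
  have r: "0 < r" "r < 1" "\<bar>t\<bar> < r" using t by (auto simp: r_def)
  define S where "S = ball (0 :: real) r"
  define f' where "f' k x = w k * (real (Suc k) * x ^ k / (1 + x ^ Suc k))" for k and x :: real
  have low: "1 - r \<le> 1 + x ^ Suc k" if "x \<in> S" for x k
  proof -
    have "\<bar>x\<bar> ^ Suc k \<le> \<bar>x\<bar> ^ 1" using that r by (intro power_decreasing) (auto simp: S_def)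
    then have "\<bar>x ^ Suc k\<bar> \<le> r" using that by (simp only: power_abs) (simp add: S_def)
    then show ?thesis by linarith
  qed
  have "((\<lambda>x. \<Sum>k. w k * ln (1 + x ^ Suc k)) has_field_derivative (\<Sum>k. f' k t)) (at t)"
  proof (rule has_field_derivative_series'(2))
    show "convex S" by (simp add: S_def)
    show "((\<lambda>x. w k * ln (1 + x ^ Suc k)) has_field_derivative f' k x) (at x within S)"
      if "x \<in> S" for k x
    proof -
      have "((\<lambda>x. 1 + x ^ Suc k) has_field_derivative real (Suc k) * x ^ k) (at x within S)"
        by (rule derivative_eq_intros refl)+ simp
      moreover have "0 < 1 + x ^ Suc k" using low[OF that, of k] r by linarith
      ultimately have "((\<lambda>x. ln (1 + x ^ Suc k)) has_field_derivative
          inverse (1 + x ^ Suc k) * (real (Suc k) * x ^ k)) (at x within S)"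
        by (intro DERIV_chain2[OF DERIV_ln])
      from DERIV_cmult[OF this, of "w k"] show ?thesis by (simp add: f'_def divide_inverse mult_ac)
    qed
    show "uniformly_convergent_on S (\<lambda>n x. \<Sum>i<n. f' i x)"
    proof (rule Weierstrass_m_test')
      fix k x assume x: "x \<in> S"
      have "\<bar>f' k x\<bar> = \<bar>w k\<bar> * (real (Suc k) * \<bar>x\<bar> ^ k / (1 + x ^ Suc k))"
        using low[OF x, of k] r by (simp add: f'_def abs_mult power_abs)
      also have "\<dots> \<le> 1 * (real (Suc k) * r ^ k / (1 - r))"
        using low[OF x, of k] r w[of k] x
        by (intro mult_mono frac_le mult_left_mono power_mono) (auto simp: S_def)
      finally show "norm (f' k x) \<le> real (Suc k) * r ^ k / (1 - r)" by simp
    next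
      have "summable (\<lambda>k. real (Suc k) * r ^ k)"
        using geometric_deriv_sums[of r] r by (auto simp: sums_iff)
      then show "summable (\<lambda>k. real (Suc k) * r ^ k / (1 - r))" by (rule summable_divide)
    qed
    show "0 \<in> S" "t \<in> interior S" using r by (auto simp: S_def interior_open)
    show "summable (\<lambda>k. w k * ln (1 + 0 ^ Suc k))" by simp
  qed
  then show ?thesis by (auto simp: real_differentiable_def)
qed

text \<open>This is tanh, written as the ratio of the two bond sums
  \<open>exp \<beta> - exp (-\<beta>)\<close> (weighted by the sign) and
  \<open>exp \<beta> + exp (-\<beta>)\<close>.\<close>

definition magnetization :: "real \<Rightarrow> real" where
  "magnetization \<beta> = (exp \<beta> - exp (-\<beta>)) / (exp \<beta> + exp (-\<beta>))"

lemma abs_magnetization: "\<bar>magnetization \<beta>\<bar> < 1"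
  unfolding magnetization_def
  by (simp add: abs_divide abs_less_iff add_pos_pos divide_less_eq)

lemma magnetization_has_derivative:
  "\<exists>d. (magnetization has_real_derivative d) (at \<beta>)"
proof -
  have "exp \<beta> + exp (-\<beta>) \<noteq> 0" using add_pos_pos[OF exp_gt_zero exp_gt_zero] by (metis less_irrefl)
  then show ?thesis
    unfolding magnetization_def[abs_def] by (auto intro!: exI derivative_eq_intros)
qed

fun explicit_energy :: "bc \<Rightarrow> nat \<Rightarrow> nat \<Rightarrow> real \<Rightarrow> real" where
  "explicit_energy BC1 p1 p2 \<beta> = ln (exp \<beta> + exp (-\<beta>)) - ln 2"
| "explicit_energy BC2 p1 p2 \<beta> =
    ln (exp \<beta> + exp (-\<beta>)) - (2 * real p1 * real p2 - 1) / (real p1 * real p2) * ln 2"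
| "explicit_energy BCp p1 p2 \<beta> =
    ln (exp \<beta> + exp (-\<beta>)) - (2 * real p1 * real p2 - 1) / (real p1 * real p2) * ln 2
    + (\<Sum>k. (real p1 * real p2 - 1)\<^sup>2 / (real p1 * real p2) ^ (Suc k + 1)
        * ln (1 + magnetization \<beta> ^ Suc k))"

section \<open>Finite-dimensional marginals of the spin measure\<close>

abbreviation spins :: "site set \<Rightarrow> (site \<Rightarrow> real) set" where
  "spins V \<equiv> PiE V (\<lambda>_. {1, -1})"

lemma finite_spins [simp]: "finite V \<Longrightarrow> finite (spins V)"
  by (intro finite_PiE) auto

lemma space_spin_measure: "space spin_measure = spins lattice"
  by (simp add: spin_measure_def space_PiM space_uniform_count_measure)

interpretation spin: product_prob_space "\<lambda>_. uniform_count_measure {1, -1 :: real}" lattice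
proof -
  have "prob_space (uniform_count_measure {1, -1 :: real})"
    by (rule prob_space_uniform_count_measure) auto
  then interpret prob_space "uniform_count_measure {1, -1 :: real}" .
  show "product_prob_space (\<lambda>_. uniform_count_measure {1, -1 :: real})"
    by unfold_locales
qed

lemma prob_space_spin_measure: "prob_space spin_measure"
  unfolding spin_measure_def by (rule spin.P.prob_space_axioms)

lemma measurable_spin [measurable]: "v \<in> lattice \<Longrightarrow> (\<lambda>\<sigma>. \<sigma> v) \<in> borel_measurable spin_measure"
proof -
  assume "v \<in> lattice"
  then have "(\<lambda>\<sigma>. \<sigma> v) \<in> spin_measure \<rightarrow>\<^sub>M uniform_count_measure {1, -1 :: real}"
    unfolding spin_measure_def by (rule measurable_component_singleton)
  moreover have "(\<lambda>x. x) \<in> borel_measurable (uniform_count_measure {1, -1 :: real})"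
    by (simp add: measurable_def sets_uniform_count_measure space_uniform_count_measure)
  ultimately show ?thesis by (rule measurable_compose)
qed

text \<open>Since \<open>g\<close> sees only the spins in \<open>V\<close>, it is constant on each
  cylinder \<open>E \<tau>\<close>. Every configuration lies in exactly one cylinder, that of its
  restriction, and all cylinders have the same probability.\<close>

lemma integral_spin_measure:
  fixes g :: "(site \<Rightarrow> real) \<Rightarrow> real"
  assumes V: "finite V" "V \<subseteq> lattice"
    and g: "\<And>\<sigma>. \<sigma> \<in> spins lattice \<Longrightarrow> g \<sigma> = g (restrict \<sigma> V)"
  shows "(\<integral>\<sigma>. g \<sigma> \<partial>spin_measure) = (\<Sum>\<tau>\<in>spins V. g \<tau>) / 2 ^ card V"
proof -
  define E where "E \<tau> = prod_emb lattice (\<lambda>_. uniform_count_measure {1, -1 :: real}) V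
    (PiE V (\<lambda>v. {\<tau> v}))" for \<tau> :: "site \<Rightarrow> real"
  have sets_E: "E \<tau> \<in> sets spin_measure" and measure_E: "measure spin_measure (E \<tau>) = 1 / 2 ^ card V"
    if \<tau>: "\<tau> \<in> spins V" for \<tau>
  proof -
    have \<tau>v: "\<tau> v \<in> {1, -1}" if "v \<in> V" for v using \<tau> that by auto
    then have *: "\<And>v. v \<in> V \<Longrightarrow> {\<tau> v} \<in> sets (uniform_count_measure {1, -1 :: real})"
      by (simp add: sets_uniform_count_measure)
    show "E \<tau> \<in> sets spin_measure"
      unfolding E_def spin_measure_def using V * by (intro sets_PiM_I) auto
    have "measure spin_measure (E \<tau>)
        = (\<Prod>v\<in>V. measure (uniform_count_measure {1, -1 :: real}) {\<tau> v})"
      unfolding E_def spin_measure_def using V * by (intro spin.measure_PiM_emb) auto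
    also have "\<dots> = (\<Prod>v\<in>V. 1 / 2)"
      using \<tau>v by (intro prod.cong refl, subst measure_uniform_count_measure) auto
    finally show "measure spin_measure (E \<tau>) = 1 / 2 ^ card V"
      by (simp add: power_one_over)
  qed
  have "(\<integral>\<sigma>. g \<sigma> \<partial>spin_measure) = (\<integral>\<sigma>. (\<Sum>\<tau>\<in>spins V. g \<tau> * indicator (E \<tau>) \<sigma>) \<partial>spin_measure)"
  proof (rule Bochner_Integration.integral_cong[OF refl])
    fix \<sigma> assume "\<sigma> \<in> space spin_measure"
    then have \<sigma>: "\<sigma> \<in> spins lattice" by (simp add: space_spin_measure)
    have "indicator (E \<tau>) \<sigma> = (if \<tau> = restrict \<sigma> V then 1 else 0 :: real)" if \<tau>: "\<tau> \<in> spins V" for \<tau>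
    proof -
      have "\<sigma> \<in> E \<tau> \<longleftrightarrow> restrict \<sigma> V \<in> PiE V (\<lambda>v. {\<tau> v})"
        using \<sigma> by (simp add: E_def prod_emb_def space_uniform_count_measure)
      also have "\<dots> \<longleftrightarrow> \<tau> = restrict \<sigma> V"
      proof
        assume *: "restrict \<sigma> V \<in> PiE V (\<lambda>v. {\<tau> v})"
        show "\<tau> = restrict \<sigma> V"
        proof
          fix v show "\<tau> v = restrict \<sigma> V v"
            using PiE_mem[OF *, of v] PiE_arb[OF \<tau>, of v] by (cases "v \<in> V") auto
        qed
      qed auto
      finally show ?thesis by (simp add: indicator_def)
    qed
    then have "(\<Sum>\<tau>\<in>spins V. g \<tau> * indicator (E \<tau>) \<sigma>)
        = (\<Sum>\<tau>\<in>spins V. if \<tau> = restrict \<sigma> V then g \<tau> else 0)"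
      by (intro sum.cong) auto
    moreover have "restrict \<sigma> V \<in> spins V" using \<sigma> V(2) by auto
    ultimately show "g \<sigma> = (\<Sum>\<tau>\<in>spins V. g \<tau> * indicator (E \<tau>) \<sigma>)"
      using V(1) g[OF \<sigma>] by simp
  qed
  also have "\<dots> = (\<Sum>\<tau>\<in>spins V. \<integral>\<sigma>. g \<tau> * indicator (E \<tau>) \<sigma> \<partial>spin_measure)"
  proof (rule Bochner_Integration.integral_sum)
    fix \<tau> assume "\<tau> \<in> spins V"
    then show "integrable spin_measure (\<lambda>\<sigma>. g \<tau> * indicator (E \<tau>) \<sigma>)"
      using sets_E prob_space_spin_measure
      by (intro integrable_mult_right integrable_real_indicator)
        (auto simp: less_top[symmetric] finite_measure.emeasure_finite prob_space_def)
  qed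
  also have "\<dots> = (\<Sum>\<tau>\<in>spins V. g \<tau> / 2 ^ card V)"
    using sets_E measure_E by (intro sum.cong) (auto simp: sets.Int_space_eq2)
  finally show ?thesis by (simp add: sum_divide_distrib)
qed

section \<open>Chains\<close>

locale chains =
  fixes p1 p2 :: nat
  assumes p1: "p1 \<ge> 1" and p2: "p2 \<ge> 1" and p1p2: "p1 * p2 \<ge> 2"
begin

definition next_site :: "site \<Rightarrow> site" where
  "next_site v = (p1 * fst v, p2 * snd v)"

lemma inj_next_site: "inj next_site"
  using p1 p2 by (auto simp: inj_def next_site_def prod_eq_iff)

lemma box_iff: "v \<in> box N1 N2 \<longleftrightarrow> 1 \<le> fst v \<and> fst v \<le> N1 \<and> 1 \<le> snd v \<and> snd v \<le> N2"
  by (cases v) (auto simp: box_def)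

lemma finite_box [simp]: "finite (box N1 N2)" and card_box: "card (box N1 N2) = N1 * N2"
  by (auto simp: box_def)

lemma sites_eq: "sites p1 p2 N1 N2 = box N1 N2 \<union> next_site ` box N1 N2"
  by (simp add: sites_def next_site_def case_prod_unfold)

lemma finite_sites [simp]: "finite (sites p1 p2 N1 N2)"
  by (simp add: sites_eq)

lemma box_subset_sites: "box N1 N2 \<subseteq> sites p1 p2 N1 N2"
  by (auto simp: sites_eq)

lemma next_site_sites: "v \<in> box N1 N2 \<Longrightarrow> next_site v \<in> sites p1 p2 N1 N2"
  by (auto simp: sites_eq)

lemma sites_subset_lattice: "sites p1 p2 N1 N2 \<subseteq> lattice"
  using p1 p2 by (auto simp: sites_eq next_site_def lattice_def box_iff)

text \<open>If one multiplier is 1, only one coordinate grows, so the sum of coordinates is used. It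
  is the measure behind walking back to the start of a chain and behind recovering spins from its
  end.\<close>

lemma next_site_increasing:
  assumes "v \<in> box N1 N2"
  shows "fst v + snd v < fst (next_site v) + snd (next_site v)"
proof -
  have "p1 \<ge> 2 \<or> p2 \<ge> 2" using p1p2 p1 p2 by (cases "p1 = 1") auto
  then have "fst v * 1 + snd v * 1 < fst v * p1 + snd v * p2"
  proof
    assume "p1 \<ge> 2"
    then have "fst v * 1 < fst v * p1" "snd v * 1 \<le> snd v * p2"
      using assms p2 by (auto simp: box_iff intro!: mult_le_mono)
    then show ?thesis by linarith
  next
    assume "p2 \<ge> 2"
    then have "fst v * 1 \<le> fst v * p1" "snd v * 1 < snd v * p2"
      using assms p1 by (auto simp: box_iff intro!: mult_le_mono)
    then show ?thesis by linarith
  qed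
  then show ?thesis by (simp add: next_site_def mult.commute)
qed

text \<open>A site has its successor in the box exactly when it lies in the box of quotients. This
  self-similarity is why the chain counts are differences of products of quotients.\<close>

lemma next_site_Int_box: "next_site ` box N1 N2 \<inter> box N1 N2 = next_site ` box (N1 div p1) (N2 div p2)"
proof -
  have "next_site v \<in> box N1 N2 \<longleftrightarrow> v \<in> box (N1 div p1) (N2 div p2)" for v
    using p1 p2 by (auto simp: next_site_def box_iff less_eq_div_iff_mult_less_eq mult.commute Suc_le_eq)
  moreover have "box (N1 div p1) (N2 div p2) \<subseteq> box N1 N2"
    by (auto simp: box_iff intro: order_trans[OF _ div_le_dividend])
  ultimately show ?thesis by auto
qed

lemma chain_starts_eq: "chain_starts p1 p2 N1 N2 = box N1 N2 - next_site ` box N1 N2"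
proof -
  have "p1 dvd fst v \<and> p2 dvd snd v \<longleftrightarrow> v \<in> next_site ` box N1 N2" if v: "v \<in> box N1 N2" for v
  proof
    assume "p1 dvd fst v \<and> p2 dvd snd v"
    then obtain a b where ab: "fst v = p1 * a" "snd v = p2 * b" by (auto elim!: dvdE)
    have "a \<le> p1 * a" "b \<le> p2 * b" using p1 p2 by auto
    moreover have "1 \<le> a" "1 \<le> b" using v ab by (auto simp: box_iff Suc_le_eq)
    ultimately have "(a, b) \<in> box N1 N2" using v ab unfolding box_iff by (metis fst_conv snd_conv order_trans)
    moreover have "v = next_site (a, b)" using ab by (simp add: next_site_def prod_eq_iff)
    ultimately show "v \<in> next_site ` box N1 N2" by blast
  qed (auto simp: next_site_def)
  then show ?thesis by (fastforce simp: chain_starts_def)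
qed

lemma finite_chain_starts [simp]: "finite (chain_starts p1 p2 N1 N2)"
  by (simp add: chain_starts_eq)

lemma card_chain_starts:
  "card (chain_starts p1 p2 N1 N2) = N1 * N2 - (N1 div p1) * (N2 div p2)"
proof -
  have "card (box N1 N2 - next_site ` box N1 N2) = card (box N1 N2) - card (next_site ` box N1 N2 \<inter> box N1 N2)"
    by (subst card_Diff_subset_Int) (auto simp: Int_commute)
  then show ?thesis
    using inj_next_site by (simp add: chain_starts_eq next_site_Int_box card_image inj_on_subset card_box)
qed

text \<open>Each chain leaves the box at exactly one site. The count needs no explicit bijection:
  the box and its image under the injective \<open>next_site\<close> have equal size, hence the same
  number of elements outside their intersection.\<close>

lemma card_sites_Diff_box:
  "card (sites p1 p2 N1 N2 - box N1 N2) = card (chain_starts p1 p2 N1 N2)"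
proof -
  have "sites p1 p2 N1 N2 - box N1 N2 = next_site ` box N1 N2 - box N1 N2"
    by (auto simp: sites_eq)
  then have "card (sites p1 p2 N1 N2 - box N1 N2)
      = card (next_site ` box N1 N2) - card (next_site ` box N1 N2 \<inter> box N1 N2)"
    by (simp add: card_Diff_subset_Int)
  also have "card (next_site ` box N1 N2) = card (box N1 N2)"
    using inj_next_site by (simp add: card_image inj_on_subset)
  also have "card (box N1 N2) - card (next_site ` box N1 N2 \<inter> box N1 N2)
      = card (box N1 N2 - next_site ` box N1 N2)"
    by (subst card_Diff_subset_Int) (auto simp: Int_commute)
  finally show ?thesis by (simp add: chain_starts_eq)
qed

lemma card_sites: "card (sites p1 p2 N1 N2) = N1 * N2 + card (chain_starts p1 p2 N1 N2)"
  using card_Diff_subset[OF finite_box box_subset_sites, of N1 N2]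
    card_mono[OF finite_sites box_subset_sites, of N1 N2] card_sites_Diff_box[of N1 N2]
  by (simp add: card_box)

section \<open>Chains as a partition of the box\<close>

lemma chain_site_0 [simp]: "chain_site p1 p2 c 0 = c"
  by (simp add: chain_site_def)

lemma chain_site_Suc: "chain_site p1 p2 c (Suc m) = next_site (chain_site p1 p2 c m)"
  by (simp add: chain_site_def next_site_def ac_simps)

text \<open>The steps at which a chain is in the box form a downward closed set, bounded because one
  of the coordinates grows at least like \<open>2 ^ m\<close>. It is an initial segment of the
  naturals, so its cardinality is the step of the first exit.\<close>

lemma chain_site_box_iff:
  assumes c: "c \<in> box N1 N2"
  shows "chain_site p1 p2 c m \<in> box N1 N2 \<longleftrightarrow> m < chain_length p1 p2 N1 N2 c"
proof -
  define A where "A = {m. chain_site p1 p2 c m \<in> box N1 N2}"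
  have down: "m \<in> A" if "n \<in> A" "m \<le> n" for m n
  proof -
    have "fst c * p1 ^ m \<le> fst c * p1 ^ n" "snd c * p2 ^ m \<le> snd c * p2 ^ n"
      using that p1 p2 by (auto intro!: mult_le_mono power_increasing)
    moreover have "1 \<le> fst c * p1 ^ m" "1 \<le> snd c * p2 ^ m"
      using c p1 p2 by (auto simp: box_iff Suc_le_eq)
    ultimately show ?thesis
      using that(1) unfolding A_def chain_site_def box_iff mem_Collect_eq fst_conv snd_conv
      by (meson order_trans)
  qed
  have "m < N1 + N2" if "m \<in> A" for m
  proof -
    have N: "fst c * p1 ^ m \<le> N1" "snd c * p2 ^ m \<le> N2"
      using that by (auto simp: A_def chain_site_def box_iff)
    have "p1 \<ge> 2 \<or> p2 \<ge> 2" using p1p2 p1 p2 by (cases "p1 = 1") auto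
    then show ?thesis
    proof
      assume "p1 \<ge> 2"
      have "m < 2 ^ m" by (rule less_exp)
      also have "\<dots> \<le> p1 ^ m" using \<open>p1 \<ge> 2\<close> by (rule power_mono) simp
      also have "\<dots> \<le> fst c * p1 ^ m" using c by (simp add: box_iff)
      finally show ?thesis using N by linarith
    next
      assume "p2 \<ge> 2"
      have "m < 2 ^ m" by (rule less_exp)
      also have "\<dots> \<le> p2 ^ m" using \<open>p2 \<ge> 2\<close> by (rule power_mono) simp
      also have "\<dots> \<le> snd c * p2 ^ m" using c by (simp add: box_iff)
      finally show ?thesis using N by linarith
    qed
  qed
  then have fin: "finite A" by (meson finite_nat_set_iff_bounded)
  have A: "A = {..<card A}"
  proof (rule card_subset_eq[symmetric])
    show "{..<card A} \<subseteq> A"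
    proof (rule ccontr)
      assume "\<not> {..<card A} \<subseteq> A"
      then obtain m where m: "m < card A" "m \<notin> A" by auto
      then have "A \<subseteq> {..<m}" using down by (meson lessThan_iff not_le subsetI)
      then have "card A \<le> m" using card_mono[of "{..<m}" A] by simp
      then show False using m by simp
    qed
  qed (use fin in auto)
  then have "m \<in> A \<longleftrightarrow> m < card A" by (metis lessThan_iff)
  then show ?thesis by (simp add: A_def chain_length_def)
qed

text \<open>If two chains meet, one start is the image of the other under d steps; for positive d
  both its coordinates would be divisible by their multipliers, which a start forbids. Conversely,
  walking back from a box site lowers the sum of coordinates and ends at a start.\<close>

lemma bij_betw_chain_site:
  "bij_betw (\<lambda>(c, m). chain_site p1 p2 c m)
     (SIGMA c:chain_starts p1 p2 N1 N2. {..<chain_length p1 p2 N1 N2 c}) (box N1 N2)"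
    (is "bij_betw ?f ?S _")
proof (rule bij_betw_imageI)
  have starts_box: "c \<in> box N1 N2" if "c \<in> chain_starts p1 p2 N1 N2" for c
    using that by (simp add: chain_starts_eq)
  have *: "c = c' \<and> m = m'"
    if c: "c \<in> chain_starts p1 p2 N1 N2" and m: "m \<le> m'"
      and eq: "chain_site p1 p2 c m = chain_site p1 p2 c' m'" for c c' m m'
  proof -
    obtain d where d: "m' = m + d" using m le_iff_add by blast
    have "fst c = fst c' * p1 ^ d" "snd c = snd c' * p2 ^ d"
      using eq p1 p2 by (auto simp: chain_site_def d power_add)
    moreover from this have "d = 0"
      using c by (cases d) (auto simp: chain_starts_def case_prod_unfold)
    ultimately show ?thesis by (auto simp: d prod_eq_iff)
  qed
  show "inj_on ?f ?S"
  proof (rule inj_onI)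
    fix x y assume x: "x \<in> ?S" and y: "y \<in> ?S" and eq: "?f x = ?f y"
    obtain c m c' m' where xy: "x = (c, m)" "y = (c', m')" by fastforce
    show "x = y"
      using *[of c m m' c'] *[of c' m' m c] x y eq xy by (cases "m \<le> m'") auto
  qed
  have "v \<in> ?f ` ?S" if "v \<in> box N1 N2" for v
    using that
  proof (induction "fst v + snd v" arbitrary: v rule: less_induct)
    case less
    show ?case
    proof (cases "v \<in> chain_starts p1 p2 N1 N2")
      case True
      then have "(v, 0) \<in> ?S"
        using chain_site_box_iff[OF less.prems, of 0] less.prems by auto
      then show ?thesis by (rule image_eqI[rotated]) simp
    next
      case False
      then obtain u where u: "u \<in> box N1 N2" "v = next_site u"
        using less.prems by (auto simp: chain_starts_eq)
      have "u \<in> ?f ` ?S" using less.hyps[OF _ u(1)] next_site_increasing[OF u(1)] u(2) by simp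
      then obtain c m where cm: "c \<in> chain_starts p1 p2 N1 N2" "u = chain_site p1 p2 c m" by auto
      then have v: "v = chain_site p1 p2 c (Suc m)" using u by (simp add: chain_site_Suc)
      then have "(c, Suc m) \<in> ?S"
        using chain_site_box_iff[OF starts_box[OF cm(1)], of "Suc m"] less.prems cm(1) by auto
      then show ?thesis by (rule image_eqI[rotated]) (simp add: v)
    qed
  qed
  moreover have "?f ` ?S \<subseteq> box N1 N2"
    using chain_site_box_iff[OF starts_box] by auto
  ultimately show "?f ` ?S = box N1 N2" by blast
qed

lemma prod_box:
  fixes g :: "site \<Rightarrow> 'a :: comm_monoid_mult"
  shows "(\<Prod>v\<in>box N1 N2. g v) =
    (\<Prod>c\<in>chain_starts p1 p2 N1 N2. \<Prod>m<chain_length p1 p2 N1 N2 c. g (chain_site p1 p2 c m))"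
  by (subst prod.reindex_bij_betw[OF bij_betw_chain_site, symmetric], subst prod.Sigma)
    (auto simp: case_prod_unfold)

subsection \<open>Partition sums\<close>

lemma multiple_sum_eq:
  "multiple_sum p1 p2 N1 N2 \<sigma> = (\<Sum>v\<in>box N1 N2. \<sigma> v * \<sigma> (next_site v))"
  unfolding multiple_sum_def box_def next_site_def
  by (simp add: sum.cartesian_product case_prod_unfold)

text \<open>The sites outside the box are the chain ends. Keeping their spins turns the passage to
  bonds into a map of the finite configuration space into itself, so injectivity suffices for
  bijectivity.\<close>

definition bonds :: "nat \<Rightarrow> nat \<Rightarrow> (site \<Rightarrow> real) \<Rightarrow> site \<Rightarrow> real" where
  "bonds N1 N2 \<sigma> = (\<lambda>v\<in>sites p1 p2 N1 N2. if v \<in> box N1 N2 then \<sigma> v * \<sigma> (next_site v) else \<sigma> v)"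

text \<open>The spins are recovered from the bonds by running back along each chain from its end.\<close>
lemma bij_betw_bonds:
  "bij_betw (bonds N1 N2) (spins (sites p1 p2 N1 N2)) (spins (sites p1 p2 N1 N2))"
proof -
  define V where "V = sites p1 p2 N1 N2"
  have maps: "bonds N1 N2 ` spins V \<subseteq> spins V"
  proof (rule image_subsetI)
    fix \<sigma> assume \<sigma>: "\<sigma> \<in> spins V"
    have \<sigma>v: "\<sigma> v = 1 \<or> \<sigma> v = -1" if "v \<in> V" for v using \<sigma> that by auto
    show "bonds N1 N2 \<sigma> \<in> spins V"
    proof
      fix v assume v: "v \<in> V"
      then show "bonds N1 N2 \<sigma> v \<in> {1, -1}"
        using \<sigma>v[OF v] \<sigma>v[of "next_site v"] next_site_sites[of v N1 N2]
        by (auto simp: bonds_def V_def)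
    qed (simp add: bonds_def V_def)
  qed
  have inj: "inj_on (bonds N1 N2) (spins V)"
  proof (rule inj_onI, rule ccontr)
    fix \<sigma> \<tau> assume \<sigma>: "\<sigma> \<in> spins V" and \<tau>: "\<tau> \<in> spins V"
      and eq: "bonds N1 N2 \<sigma> = bonds N1 N2 \<tau>" and "\<sigma> \<noteq> \<tau>"
    \<comment> \<open>At a disagreement \<open>v\<close> with maximal sum of coordinates, equal
      bonds exclude that \<open>v\<close> is a chain end, and its successor already agrees;
      cancelling that nonzero spin makes \<open>v\<close> agree as well.\<close>
    define D where "D = {v \<in> V. \<sigma> v \<noteq> \<tau> v}"
    have "finite D" by (simp add: D_def V_def)
    moreover have "D \<noteq> {}" using PiE_ext[OF \<sigma> \<tau>] \<open>\<sigma> \<noteq> \<tau>\<close> by (auto simp: D_def)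
    ultimately have "Max ((\<lambda>u. fst u + snd u) ` D) \<in> (\<lambda>u. fst u + snd u) ` D"
      by (intro Max_in) auto
    then obtain v where v: "Max ((\<lambda>u. fst u + snd u) ` D) = fst v + snd v" "v \<in> D"
      by (rule imageE)
    have v_max: "fst u + snd u \<le> fst v + snd v" if "u \<in> D" for u
      using Max_ge[of "(\<lambda>u. fst u + snd u) ` D"] \<open>finite D\<close> that unfolding v(1)[symmetric] by simp
    have vV: "v \<in> V" using v by (simp add: D_def)
    have "bonds N1 N2 \<sigma> v = bonds N1 N2 \<tau> v" using eq by simp
    then have b: "v \<in> box N1 N2" "\<sigma> v * \<sigma> (next_site v) = \<tau> v * \<tau> (next_site v)"
      using v vV by (auto simp: D_def bonds_def V_def split: if_splits)
    have "next_site v \<notin> D" using v_max[of "next_site v"] next_site_increasing[OF b(1)] by auto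
    moreover have nV: "next_site v \<in> V" using next_site_sites[OF b(1)] by (simp add: V_def)
    ultimately have "\<sigma> (next_site v) = \<tau> (next_site v)" by (simp add: D_def)
    moreover have "\<tau> (next_site v) \<noteq> 0" using PiE_mem[OF \<tau> nV] by auto
    ultimately show False using b(2) v(2) by (simp add: D_def)
  qed
  have "finite (spins V)" by (simp add: V_def)
  from endo_inj_surj[OF this maps inj] inj show ?thesis
    by (simp add: bij_betw_def V_def)
qed

lemma sum_bonds: "multiple_sum p1 p2 N1 N2 \<sigma> = (\<Sum>v\<in>box N1 N2. bonds N1 N2 \<sigma> v)"
  unfolding multiple_sum_eq using box_subset_sites by (intro sum.cong) (auto simp: bonds_def)

lemma bonds_outside:
  "v \<in> sites p1 p2 N1 N2 - box N1 N2 \<Longrightarrow> bonds N1 N2 \<sigma> v = \<sigma> v"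
  by (simp add: bonds_def)

text \<open>The product telescopes because every intermediate spin occurs twice and has square
  1.\<close>

lemma prod_bonds_chain:
  assumes c: "c \<in> box N1 N2" and \<sigma>: "\<sigma> \<in> spins (sites p1 p2 N1 N2)"
    and "l \<le> chain_length p1 p2 N1 N2 c"
  shows "(\<Prod>m<l. bonds N1 N2 \<sigma> (chain_site p1 p2 c m)) = \<sigma> c * \<sigma> (chain_site p1 p2 c l)"
  using assms(3)
proof (induction l)
  case 0
  have "\<sigma> c \<in> {1, -1}" using \<sigma> box_subset_sites c by (auto dest: PiE_mem)
  then show ?case by auto
next
  case (Suc l)
  define v where "v = chain_site p1 p2 c l"
  have v: "v \<in> box N1 N2"
    using chain_site_box_iff[OF c, of l] Suc.prems by (simp add: v_def)
  then have "\<sigma> v \<in> {1, -1}" using \<sigma> box_subset_sites by (auto dest: PiE_mem)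
  moreover have "bonds N1 N2 \<sigma> v = \<sigma> v * \<sigma> (next_site v)"
    using v box_subset_sites by (auto simp: bonds_def)
  ultimately show ?case
    using Suc by (auto simp: v_def chain_site_Suc)
qed

lemma chain_end_sites:
  assumes c: "c \<in> box N1 N2"
  shows "chain_site p1 p2 c (chain_length p1 p2 N1 N2 c) \<in> sites p1 p2 N1 N2"
proof (cases "chain_length p1 p2 N1 N2 c")
  case 0
  then show ?thesis using chain_site_box_iff[OF c, of 0] c by simp
next
  case (Suc k)
  then have "chain_site p1 p2 c k \<in> box N1 N2" using chain_site_box_iff[OF c, of k] by simp
  then show ?thesis using Suc next_site_sites by (simp add: chain_site_Suc)
qed

definition partition_sum :: "nat \<Rightarrow> nat \<Rightarrow> real \<Rightarrow> ((site \<Rightarrow> real) \<Rightarrow> bool) \<Rightarrow> real" where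
  "partition_sum N1 N2 \<beta> P =
     (\<Sum>\<sigma> | \<sigma> \<in> spins (sites p1 p2 N1 N2) \<and> P \<sigma>. exp (\<beta> * multiple_sum p1 p2 N1 N2 \<sigma>))"

lemma partition_sum_bonds:
  assumes "\<And>\<sigma>. \<sigma> \<in> spins (sites p1 p2 N1 N2) \<Longrightarrow> P \<sigma> \<longleftrightarrow> Q (bonds N1 N2 \<sigma>)"
  shows "partition_sum N1 N2 \<beta> P =
    (\<Sum>\<tau> | \<tau> \<in> spins (sites p1 p2 N1 N2) \<and> Q \<tau>. \<Prod>v\<in>box N1 N2. exp (\<beta> * \<tau> v))"
proof -
  let ?V = "sites p1 p2 N1 N2"
  let ?g = "\<lambda>\<tau>. if Q \<tau> then \<Prod>v\<in>box N1 N2. exp (\<beta> * \<tau> v) else 0"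
  have "partition_sum N1 N2 \<beta> P = (\<Sum>\<sigma>\<in>spins ?V. ?g (bonds N1 N2 \<sigma>))"
    unfolding partition_sum_def
    by (subst sum.inter_filter[symmetric])
      (auto simp: assms sum_bonds sum_distrib_left exp_sum intro!: sum.cong)
  also have "\<dots> = (\<Sum>\<tau>\<in>spins ?V. ?g \<tau>)"
    by (rule sum.reindex_bij_betw[OF bij_betw_bonds])
  finally show ?thesis by (simp add: sum.inter_filter)
qed

lemma partition_sum_free:
  "partition_sum N1 N2 \<beta> (\<lambda>_. True)
     = (exp \<beta> + exp (-\<beta>)) ^ (N1 * N2) * 2 ^ card (chain_starts p1 p2 N1 N2)"
proof -
  let ?V = "sites p1 p2 N1 N2"
  have "partition_sum N1 N2 \<beta> (\<lambda>_. True) = (\<Sum>\<tau>\<in>spins ?V. \<Prod>v\<in>box N1 N2. exp (\<beta> * \<tau> v))"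
    using partition_sum_bonds[of N1 N2 "\<lambda>_. True" "\<lambda>_. True"] by simp
  \<comment> \<open>Padding with the factor 1 outside the box gives one factor per coordinate of the
    configuration, so that the sum over configurations becomes a product of sums over single
    spins.\<close>
  also have "\<dots> = (\<Sum>\<tau>\<in>spins ?V. \<Prod>v\<in>?V. if v \<in> box N1 N2 then exp (\<beta> * \<tau> v) else 1)"
    using box_subset_sites by (simp add: prod.inter_restrict[symmetric] Int_absorb1)
  also have "\<dots> = (\<Prod>v\<in>?V. \<Sum>s\<in>{1, -1}. if v \<in> box N1 N2 then exp (\<beta> * s) else 1)"
    by (rule prod_sum_PiE[symmetric]) auto
  also have "\<dots> = (\<Prod>v\<in>box N1 N2 \<union> (?V - box N1 N2). if v \<in> box N1 N2 then exp \<beta> + exp (-\<beta>) else 2)"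
    using box_subset_sites by (intro prod.cong) auto
  also have "\<dots> = (exp \<beta> + exp (-\<beta>)) ^ (N1 * N2) * 2 ^ card (chain_starts p1 p2 N1 N2)"
    by (subst prod.union_disjoint) (auto simp: card_box card_sites_Diff_box)
  finally show ?thesis .
qed

lemma partition_sum_ends:
  "partition_sum N1 N2 \<beta> (\<lambda>\<sigma>. \<forall>v\<in>sites p1 p2 N1 N2 - box N1 N2. \<sigma> v = 1)
     = (exp \<beta> + exp (-\<beta>)) ^ (N1 * N2)"
proof -
  let ?V = "sites p1 p2 N1 N2"
  let ?A = "\<lambda>v. if v \<in> box N1 N2 then {1, -1 :: real} else {1}"
  have "partition_sum N1 N2 \<beta> (\<lambda>\<sigma>. \<forall>v\<in>?V - box N1 N2. \<sigma> v = 1)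
      = (\<Sum>\<tau> | \<tau> \<in> spins ?V \<and> (\<forall>v\<in>?V - box N1 N2. \<tau> v = 1). \<Prod>v\<in>box N1 N2. exp (\<beta> * \<tau> v))"
    by (intro partition_sum_bonds) (simp add: bonds_outside)
  also have "{\<tau>. \<tau> \<in> spins ?V \<and> (\<forall>v\<in>?V - box N1 N2. \<tau> v = 1)} = PiE ?V ?A"
    by (auto simp: PiE_iff extensional_def split: if_splits)
  also have "(\<Sum>\<tau>\<in>PiE ?V ?A. \<Prod>v\<in>box N1 N2. exp (\<beta> * \<tau> v))
      = (\<Sum>\<tau>\<in>PiE ?V ?A. \<Prod>v\<in>?V. if v \<in> box N1 N2 then exp (\<beta> * \<tau> v) else 1)"
    using box_subset_sites by (simp add: prod.inter_restrict[symmetric] Int_absorb1)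
  also have "\<dots> = (\<Prod>v\<in>?V. \<Sum>s\<in>?A v. if v \<in> box N1 N2 then exp (\<beta> * s) else 1)"
    by (rule prod_sum_PiE[symmetric]) auto
  also have "\<dots> = (\<Prod>v\<in>?V. if v \<in> box N1 N2 then exp \<beta> + exp (-\<beta>) else 1)"
    by (intro prod.cong) auto
  also have "\<dots> = (exp \<beta> + exp (-\<beta>)) ^ (N1 * N2)"
    using box_subset_sites[of N1 N2]
    by (simp add: prod.inter_restrict[symmetric] Int_absorb1 card_box)
  finally show ?thesis .
qed

text \<open>Expanding the product over chains of the indicators \<open>(1 + \<sigma> start * \<sigma> end) / 2\<close> gives one term
  for each set \<open>D\<close> of chains, and every term factorises over the bonds.\<close>
lemma partition_sum_periodic:
  "partition_sum N1 N2 \<beta> (satisfies_bc BCp p1 p2 N1 N2)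
     = (\<Prod>c\<in>chain_starts p1 p2 N1 N2.
          (exp \<beta> + exp (-\<beta>)) ^ chain_length p1 p2 N1 N2 c
          + (exp \<beta> - exp (-\<beta>)) ^ chain_length p1 p2 N1 N2 c)"
proof -
  let ?V = "sites p1 p2 N1 N2" and ?B = "box N1 N2" and ?C = "chain_starts p1 p2 N1 N2"
  let ?l = "chain_length p1 p2 N1 N2"
  let ?site = "\<lambda>c m. chain_site p1 p2 c m"
  let ?a = "exp \<beta> + exp (-\<beta>)" and ?b = "exp \<beta> - exp (-\<beta>)"
  \<comment> \<open>By telescoping, periodicity of a chain says that its bonds multiply to 1. The
    constraint thus concerns the bonds in the box only, and the chain ends remain free.\<close>
  define Q where "Q \<tau> \<longleftrightarrow> (\<forall>c\<in>?C. (\<Prod>m<?l c. \<tau> (?site c m)) = 1)" for \<tau> :: "site \<Rightarrow> real"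
  \<comment> \<open>The start of the chain through a box site; it turns the choice of a set
    \<open>D\<close> of chains into a condition on single sites.\<close>
  define root where
    "root = (\<lambda>v. fst (the_inv_into (SIGMA c:?C. {..<?l c}) (\<lambda>(c, m). ?site c m) v))"
  have starts_box: "c \<in> ?B" if "c \<in> ?C" for c using that by (simp add: chain_starts_eq)
  have site_box: "?site c m \<in> ?B" if "c \<in> ?C" "m < ?l c" for c m
    using chain_site_box_iff[OF starts_box] that by simp
  have root: "root (?site c m) = c" if "c \<in> ?C" "m < ?l c" for c m
    using the_inv_into_f_f[OF bij_betw_imp_inj_on[OF bij_betw_chain_site], of "(c, m)"] that
    by (simp add: root_def)
  have end_sites: "?site c (?l c) \<in> ?V" if "c \<in> ?C" for c
    using chain_end_sites starts_box[OF that] .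
  have chain_pm: "(\<Prod>m<?l c. \<tau> (?site c m)) \<in> {1, -1}" if "\<tau> \<in> spins ?V" "c \<in> ?C" for \<tau> c
  proof -
    have "(\<Prod>m<k. \<tau> (?site c m)) \<in> {1, -1}" if "k \<le> ?l c" for k
      using that
    proof (induction k)
      case (Suc k)
      have "\<tau> (?site c k) \<in> {1, -1}"
        using \<open>\<tau> \<in> spins ?V\<close> site_box[OF \<open>c \<in> ?C\<close>, of k] box_subset_sites Suc.prems
        by (auto dest: PiE_mem)
      then show ?case using Suc by auto
    qed simp
    then show ?thesis by blast
  qed
  have "partition_sum N1 N2 \<beta> (satisfies_bc BCp p1 p2 N1 N2)
      = (\<Sum>\<tau> | \<tau> \<in> spins ?V \<and> Q \<tau>. \<Prod>v\<in>?B. exp (\<beta> * \<tau> v))"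
  proof (rule partition_sum_bonds)
    fix \<sigma> assume \<sigma>: "\<sigma> \<in> spins ?V"
    have "\<sigma> c = \<sigma> (?site c (?l c)) \<longleftrightarrow> (\<Prod>m<?l c. bonds N1 N2 \<sigma> (?site c m)) = 1"
      if c: "c \<in> ?C" for c
    proof -
      have "\<sigma> c \<in> {1, -1}" "\<sigma> (?site c (?l c)) \<in> {1, -1}"
        using PiE_mem[OF \<sigma>] starts_box[OF c] box_subset_sites end_sites[OF c] by blast+
      then show ?thesis by (auto simp: prod_bonds_chain[OF starts_box[OF c] \<sigma>])
    qed
    then show "satisfies_bc BCp p1 p2 N1 N2 \<sigma> \<longleftrightarrow> Q (bonds N1 N2 \<sigma>)"
      by (simp add: Q_def)
  qed
  also have "\<dots> = (\<Sum>\<tau>\<in>spins ?V. if Q \<tau> then \<Prod>v\<in>?B. exp (\<beta> * \<tau> v) else 0)"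
    by (simp add: sum.inter_filter)
  also have "\<dots> = (\<Sum>\<tau>\<in>spins ?V. (\<Prod>v\<in>?B. exp (\<beta> * \<tau> v)) *
      (\<Prod>c\<in>?C. ((\<Prod>m<?l c. \<tau> (?site c m)) + 1) / 2))"
  proof (rule sum.cong[OF refl])
    fix \<tau> assume \<tau>: "\<tau> \<in> spins ?V"
    show "(if Q \<tau> then \<Prod>v\<in>?B. exp (\<beta> * \<tau> v) else 0)
      = (\<Prod>v\<in>?B. exp (\<beta> * \<tau> v)) * (\<Prod>c\<in>?C. ((\<Prod>m<?l c. \<tau> (?site c m)) + 1) / 2)"
    proof (cases "Q \<tau>")
      case False
      then obtain c where c: "c \<in> ?C" "(\<Prod>m<?l c. \<tau> (?site c m)) \<noteq> 1" by (auto simp: Q_def)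
      then have "(\<Prod>m<?l c. \<tau> (?site c m)) = -1" using chain_pm[OF \<tau> c(1)] by blast
      then have "\<exists>c\<in>?C. ((\<Prod>m<?l c. \<tau> (?site c m)) + 1) / 2 = 0" using c by (intro bexI) auto
      then have "(\<Prod>c\<in>?C. ((\<Prod>m<?l c. \<tau> (?site c m)) + 1) / 2) = 0"
        by (simp only: prod_zero_iff finite_chain_starts)
      then show ?thesis using False by simp
    qed (simp add: Q_def)
  qed
  also have "\<dots> = (\<Sum>\<tau>\<in>spins ?V. \<Sum>D\<in>Pow ?C. (\<Prod>v\<in>?B. exp (\<beta> * \<tau> v)) *
      (\<Prod>c\<in>D. \<Prod>m<?l c. \<tau> (?site c m))) / 2 ^ card ?C"
    by (simp add: prod_dividef prod_add sum_distrib_left sum_divide_distrib)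
  also have "(\<Sum>\<tau>\<in>spins ?V. \<Sum>D\<in>Pow ?C. (\<Prod>v\<in>?B. exp (\<beta> * \<tau> v)) *
      (\<Prod>c\<in>D. \<Prod>m<?l c. \<tau> (?site c m)))
      = (\<Sum>D\<in>Pow ?C. \<Sum>\<tau>\<in>spins ?V. (\<Prod>v\<in>?B. exp (\<beta> * \<tau> v)) *
      (\<Prod>c\<in>D. \<Prod>m<?l c. \<tau> (?site c m)))"
    by (rule sum.swap)
  \<comment> \<open>A bond on a chain in \<open>D\<close> carries the extra weight \<open>s\<close>
    and sums to \<open>?b\<close>, any other bond sums to \<open>?a\<close>. Each free chain end
    gives a factor 2, which cancels the denominators of the indicators.\<close>
  also have "\<dots> = (\<Sum>D\<in>Pow ?C. 2 ^ card ?C * ((\<Prod>c\<in>D. ?b ^ ?l c) * (\<Prod>c\<in>?C - D. ?a ^ ?l c)))"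
  proof (rule sum.cong[OF refl])
    fix D assume "D \<in> Pow ?C"
    then have D: "D \<subseteq> ?C" by simp
    let ?g = "\<lambda>v s. exp (\<beta> * s) * (if root v \<in> D then s else 1)"
    have "(\<Prod>c\<in>D. \<Prod>m<?l c. \<tau> (?site c m)) = (\<Prod>v\<in>?B. if root v \<in> D then \<tau> v else 1)"
      for \<tau> :: "site \<Rightarrow> real"
    proof -
      have "(\<Prod>v\<in>?B. if root v \<in> D then \<tau> v else 1)
          = (\<Prod>c\<in>?C. \<Prod>m<?l c. if c \<in> D then \<tau> (?site c m) else 1)"
        unfolding prod_box by (intro prod.cong refl) (simp add: root)
      also have "\<dots> = (\<Prod>c\<in>?C. if c \<in> D then \<Prod>m<?l c. \<tau> (?site c m) else 1)"
        by (intro prod.cong) auto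
      also have "\<dots> = (\<Prod>c\<in>D. \<Prod>m<?l c. \<tau> (?site c m))"
        using D by (simp add: prod.inter_restrict[symmetric] Int_absorb1)
      finally show ?thesis by simp
    qed
    then have "(\<Sum>\<tau>\<in>spins ?V. (\<Prod>v\<in>?B. exp (\<beta> * \<tau> v)) * (\<Prod>c\<in>D. \<Prod>m<?l c. \<tau> (?site c m)))
        = (\<Sum>\<tau>\<in>spins ?V. \<Prod>v\<in>?V. if v \<in> ?B then ?g v (\<tau> v) else 1)"
      using box_subset_sites
      by (simp add: prod.inter_restrict[symmetric] Int_absorb1 prod.distrib)
    also have "\<dots> = (\<Prod>v\<in>?V. \<Sum>s\<in>{1, -1}. if v \<in> ?B then ?g v s else 1)"
      by (rule prod_sum_PiE[symmetric]) auto
    also have "\<dots> = (\<Prod>v\<in>?B \<union> (?V - ?B). if v \<in> ?B then if root v \<in> D then ?b else ?a else 2)"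
      using box_subset_sites by (intro prod.cong) auto
    also have "\<dots> = (\<Prod>v\<in>?B. if root v \<in> D then ?b else ?a) * 2 ^ card ?C"
      by (subst prod.union_disjoint) (auto simp: card_sites_Diff_box)
    also have "(\<Prod>v\<in>?B. if root v \<in> D then ?b else ?a)
        = (\<Prod>c\<in>?C. \<Prod>m<?l c. if c \<in> D then ?b else ?a)"
      unfolding prod_box by (intro prod.cong refl) (simp add: root)
    also have "\<dots> = (\<Prod>c\<in>D \<union> (?C - D). if c \<in> D then ?b ^ ?l c else ?a ^ ?l c)"
      using D by (intro prod.cong) auto
    also have "\<dots> = (\<Prod>c\<in>D. ?b ^ ?l c) * (\<Prod>c\<in>?C - D. ?a ^ ?l c)"
      using D finite_subset[OF D] by (subst prod.union_disjoint) auto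
    finally show "(\<Sum>\<tau>\<in>spins ?V. (\<Prod>v\<in>?B. exp (\<beta> * \<tau> v)) * (\<Prod>c\<in>D. \<Prod>m<?l c. \<tau> (?site c m)))
        = 2 ^ card ?C * ((\<Prod>c\<in>D. ?b ^ ?l c) * (\<Prod>c\<in>?C - D. ?a ^ ?l c))"
      by simp
  qed
  also have "\<dots> / 2 ^ card ?C = (\<Prod>c\<in>?C. ?b ^ ?l c + ?a ^ ?l c)"
    by (simp add: prod_add sum_distrib_left[symmetric])
  also have "\<dots> = (\<Prod>c\<in>?C. ?a ^ ?l c + ?b ^ ?l c)" by (simp only: add.commute)
  finally show ?thesis .
qed

subsection \<open>Resetting boundary spins\<close>

text \<open>A spin occurs in at most two products, once as the first factor and once as the
  successor of a unique site, and each product changes by at most 2.\<close>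

lemma multiple_sum_reset:
  assumes \<sigma>: "\<sigma> \<in> spins (sites p1 p2 N1 N2)"
  shows "\<bar>multiple_sum p1 p2 N1 N2 \<sigma> - multiple_sum p1 p2 N1 N2 (\<sigma>(w := 1))\<bar> \<le> 4"
proof -
  let ?\<tau> = "\<sigma>(w := 1)"
  let ?B = "box N1 N2"
  have "\<bar>\<Sum>v\<in>?B. \<sigma> v * \<sigma> (next_site v) - ?\<tau> v * ?\<tau> (next_site v)\<bar>
      \<le> (\<Sum>v\<in>?B. 2 * of_bool (v = w) + 2 * of_bool (next_site v = w))"
  proof (rule order_trans[OF sum_abs], rule sum_mono)
    fix v assume v: "v \<in> ?B"
    have "\<sigma> v \<in> {1, -1}" "\<sigma> (next_site v) \<in> {1, -1}"
      using PiE_mem[OF \<sigma>] v box_subset_sites next_site_sites by blast+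
    then show "\<bar>\<sigma> v * \<sigma> (next_site v) - ?\<tau> v * ?\<tau> (next_site v)\<bar>
        \<le> 2 * of_bool (v = w) + 2 * of_bool (next_site v = w)"
      by auto
  qed
  also have "\<dots> = 2 * real (card (?B \<inter> {v. v = w})) + 2 * real (card (?B \<inter> {v. next_site v = w}))"
    by (simp add: sum.distrib sum_distrib_left[symmetric] sum_of_bool_eq del: sum.If_cases)
  also have "\<dots> \<le> 2 * 1 + 2 * 1"
  proof -
    have "card (?B \<inter> {v. v = w}) \<le> Suc 0" by (subst card_le_Suc0_iff_eq) auto
    moreover have "card (?B \<inter> {v. next_site v = w}) \<le> Suc 0"
      by (subst card_le_Suc0_iff_eq) (auto dest: injD[OF inj_next_site])
    ultimately show ?thesis by linarith
  qed
  finally show ?thesis by (simp add: multiple_sum_eq sum_subtractf)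
qed

text \<open>Flipping \<open>w\<close> maps the configurations with value -1 there injectively to
  those with value 1, at the cost of a factor \<open>exp (4 * \<bar>\<beta>\<bar>)\<close>; both
  halves together are bounded by twice that factor.\<close>

lemma partition_sum_reset_one:
  assumes w: "w \<in> sites p1 p2 N1 N2"
    and closed: "\<And>\<sigma>. P \<sigma> \<Longrightarrow> P (\<sigma>(w := 1))"
  shows "partition_sum N1 N2 \<beta> P
    \<le> 2 * exp (4 * \<bar>\<beta>\<bar>) * partition_sum N1 N2 \<beta> (\<lambda>\<sigma>. P \<sigma> \<and> \<sigma> w = 1)"
proof -
  let ?V = "sites p1 p2 N1 N2" and ?S = "multiple_sum p1 p2 N1 N2"
  let ?X = "\<lambda>s. {\<sigma>. \<sigma> \<in> spins ?V \<and> P \<sigma> \<and> \<sigma> w = s}"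
  let ?Z = "\<lambda>s. \<Sum>\<sigma>\<in>?X s. exp (\<beta> * ?S \<sigma>)"
  have fin: "finite (?X s)" for s
    by (rule finite_subset[OF _ finite_spins[OF finite_sites[of N1 N2]]]) auto
  have split: "{\<sigma>. \<sigma> \<in> spins ?V \<and> P \<sigma>} = ?X 1 \<union> ?X (-1)"
    using w by (auto dest: PiE_mem)
  have Z: "partition_sum N1 N2 \<beta> P = ?Z 1 + ?Z (-1)"
    unfolding partition_sum_def split by (rule sum.union_disjoint) (auto simp: fin[simplified])
  have "?Z (-1) \<le> (\<Sum>\<sigma>\<in>?X (-1). exp (4 * \<bar>\<beta>\<bar>) * exp (\<beta> * ?S (\<sigma>(w := 1))))"
  proof (rule sum_mono)
    fix \<sigma> assume "\<sigma> \<in> ?X (-1)"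
    then have "\<bar>?S \<sigma> - ?S (\<sigma>(w := 1))\<bar> \<le> 4" by (intro multiple_sum_reset) simp
    then have "\<bar>\<beta>\<bar> * \<bar>?S \<sigma> - ?S (\<sigma>(w := 1))\<bar> \<le> \<bar>\<beta>\<bar> * 4" by (intro mult_left_mono) auto
    moreover have "\<beta> * (?S \<sigma> - ?S (\<sigma>(w := 1))) \<le> \<bar>\<beta>\<bar> * \<bar>?S \<sigma> - ?S (\<sigma>(w := 1))\<bar>"
      by (metis abs_ge_self abs_mult)
    ultimately have "\<beta> * ?S \<sigma> \<le> 4 * \<bar>\<beta>\<bar> + \<beta> * ?S (\<sigma>(w := 1))"
      by (simp add: right_diff_distrib)
    then show "exp (\<beta> * ?S \<sigma>) \<le> exp (4 * \<bar>\<beta>\<bar>) * exp (\<beta> * ?S (\<sigma>(w := 1)))"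
      by (simp add: exp_add[symmetric])
  qed
  also have "\<dots> = exp (4 * \<bar>\<beta>\<bar>) * (\<Sum>\<sigma>\<in>(\<lambda>\<sigma>. \<sigma>(w := 1)) ` ?X (-1). exp (\<beta> * ?S \<sigma>))"
  proof -
    have "inj_on (\<lambda>\<sigma>. \<sigma>(w := 1)) (?X (-1))"
    proof (rule inj_onI)
      fix \<sigma> \<tau> assume st: "\<sigma> \<in> ?X (-1)" "\<tau> \<in> ?X (-1)" and eq: "\<sigma>(w := 1) = \<tau>(w := 1)"
      have "\<sigma> = (\<sigma>(w := 1))(w := -1)" using st(1) by (simp add: fun_eq_iff)
      also have "\<dots> = (\<tau>(w := 1))(w := -1)" by (simp only: eq)
      also have "\<dots> = \<tau>" using st(2) by (simp add: fun_eq_iff)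
      finally show "\<sigma> = \<tau>" .
    qed
    then show ?thesis by (simp only: sum.reindex sum_distrib_left o_def)
  qed
  also have "\<dots> \<le> exp (4 * \<bar>\<beta>\<bar>) * ?Z 1"
  proof (intro mult_left_mono sum_mono2 fin)
    show "(\<lambda>\<sigma>. \<sigma>(w := 1)) ` ?X (-1) \<subseteq> ?X 1"
    proof (rule image_subsetI)
      fix \<sigma> assume \<sigma>: "\<sigma> \<in> ?X (-1)"
      then have "\<sigma>(w := 1) \<in> spins (insert w ?V)" by (intro PiE_fun_upd) simp_all
      then show "\<sigma>(w := 1) \<in> ?X 1" using closed \<sigma> w by (simp only: insert_absorb) simp
    qed
  qed auto
  finally have "?Z (-1) \<le> exp (4 * \<bar>\<beta>\<bar>) * ?Z 1" .
  moreover have "1 * ?Z 1 \<le> exp (4 * \<bar>\<beta>\<bar>) * ?Z 1"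
    by (intro mult_right_mono sum_nonneg) auto
  ultimately have "partition_sum N1 N2 \<beta> P \<le> 2 * exp (4 * \<bar>\<beta>\<bar>) * ?Z 1" unfolding Z by linarith
  then show ?thesis by (simp add: partition_sum_def)
qed

lemma partition_sum_reset:
  assumes "finite W" and "W \<subseteq> sites p1 p2 N1 N2"
    and closed: "\<And>\<sigma> w. w \<in> W \<Longrightarrow> P \<sigma> \<Longrightarrow> P (\<sigma>(w := 1))"
  shows "partition_sum N1 N2 \<beta> P
    \<le> (2 * exp (4 * \<bar>\<beta>\<bar>)) ^ card W * partition_sum N1 N2 \<beta> (\<lambda>\<sigma>. P \<sigma> \<and> (\<forall>w\<in>W. \<sigma> w = 1))"
  using assms
proof (induction W rule: finite_induct)
  case (insert w W)
  let ?c = "2 * exp (4 * \<bar>\<beta>\<bar>)"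
  let ?Q = "\<lambda>\<sigma>. P \<sigma> \<and> (\<forall>w\<in>W. \<sigma> w = 1)"
  have "partition_sum N1 N2 \<beta> P \<le> ?c ^ card W * partition_sum N1 N2 \<beta> ?Q"
    using insert by auto
  also have "\<dots> \<le> ?c ^ card W * (?c * partition_sum N1 N2 \<beta> (\<lambda>\<sigma>. ?Q \<sigma> \<and> \<sigma> w = 1))"
  proof (intro mult_left_mono partition_sum_reset_one)
    fix \<sigma> assume "?Q \<sigma>"
    then show "?Q (\<sigma>(w := 1))" using insert.prems(2)[of w \<sigma>] by (simp add: fun_upd_def)
  qed (use insert.prems in auto)
  also have "(\<lambda>\<sigma>. ?Q \<sigma> \<and> \<sigma> w = 1) = (\<lambda>\<sigma>. P \<sigma> \<and> (\<forall>w\<in>insert w W. \<sigma> w = 1))" by auto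
  finally show ?case using insert.hyps by (simp add: mult_ac)
qed simp

lemma partition_sum_mono:
  assumes "\<And>\<sigma>. P \<sigma> \<Longrightarrow> Q \<sigma>"
  shows "partition_sum N1 N2 \<beta> P \<le> partition_sum N1 N2 \<beta> Q"
  unfolding partition_sum_def using assms
  by (intro sum_mono2 finite_subset[OF _ finite_spins[OF finite_sites[of N1 N2]]]) auto

subsection \<open>Energies of finite boxes\<close>

lemma multiple_sum_restrict:
  "multiple_sum p1 p2 N1 N2 (restrict \<sigma> (sites p1 p2 N1 N2)) = multiple_sum p1 p2 N1 N2 \<sigma>"
  unfolding multiple_sum_eq using box_subset_sites next_site_sites by (intro sum.cong) auto

lemma satisfies_bc_restrict:
  "satisfies_bc b p1 p2 N1 N2 (restrict \<sigma> (sites p1 p2 N1 N2)) \<longleftrightarrow> satisfies_bc b p1 p2 N1 N2 \<sigma>"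
proof (cases b)
  case BC1
  have "i \<in> sites p1 p2 N1 N2" if "i \<in> box N1 N2" for i using that box_subset_sites by blast
  then show ?thesis using BC1 by fastforce
next
  case BC2
  then show ?thesis by (simp add: case_prod_unfold)
next
  case BCp
  have "c \<in> sites p1 p2 N1 N2" "chain_site p1 p2 c (chain_length p1 p2 N1 N2 c) \<in> sites p1 p2 N1 N2"
    if "c \<in> chain_starts p1 p2 N1 N2" for c
    using that box_subset_sites chain_end_sites by (auto simp: chain_starts_eq)
  then show ?thesis using BCp by simp
qed

lemma bc_expectation_eq:
  "bc_expectation b p1 p2 N1 N2 (\<lambda>\<sigma>. exp (\<beta> * multiple_sum p1 p2 N1 N2 \<sigma>))
    = partition_sum N1 N2 \<beta> (satisfies_bc b p1 p2 N1 N2)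
      / 2 ^ (N1 * N2 + card (chain_starts p1 p2 N1 N2))"
proof -
  define g where "g \<sigma> = (if satisfies_bc b p1 p2 N1 N2 \<sigma>
    then exp (\<beta> * multiple_sum p1 p2 N1 N2 \<sigma>) else 0)" for \<sigma>
  have "bc_expectation b p1 p2 N1 N2 (\<lambda>\<sigma>. exp (\<beta> * multiple_sum p1 p2 N1 N2 \<sigma>))
      = (\<integral>\<sigma>. g \<sigma> \<partial>spin_measure)"
    unfolding bc_expectation_def
    by (intro Bochner_Integration.integral_cong) (auto simp: g_def bc_event_def)
  also have "\<dots> = (\<Sum>\<sigma>\<in>spins (sites p1 p2 N1 N2). g \<sigma>) / 2 ^ card (sites p1 p2 N1 N2)"
    by (rule integral_spin_measure[OF finite_sites sites_subset_lattice])
      (simp add: g_def multiple_sum_restrict satisfies_bc_restrict)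
  finally show ?thesis
    by (simp add: g_def partition_sum_def sum.inter_filter card_sites)
qed

lemma partition_sum_pos:
  assumes "P (\<lambda>v\<in>sites p1 p2 N1 N2. 1)"
  shows "0 < partition_sum N1 N2 \<beta> P"
  unfolding partition_sum_def
proof (rule sum_pos)
  show "finite {\<sigma>. \<sigma> \<in> spins (sites p1 p2 N1 N2) \<and> P \<sigma>}"
    by (rule finite_subset[OF _ finite_spins[OF finite_sites[of N1 N2]]]) auto
  have "(\<lambda>v\<in>sites p1 p2 N1 N2. 1) \<in> {\<sigma>. \<sigma> \<in> spins (sites p1 p2 N1 N2) \<and> P \<sigma>}"
    using assms by auto
  then show "{\<sigma>. \<sigma> \<in> spins (sites p1 p2 N1 N2) \<and> P \<sigma>} \<noteq> {}" by blast
qed simp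

text \<open>The configuration of all plus spins satisfies every boundary condition.\<close>

lemma partition_sum_bc_pos: "0 < partition_sum N1 N2 \<beta> (satisfies_bc b p1 p2 N1 N2)"
proof (rule partition_sum_pos)
  have "satisfies_bc b p1 p2 N1 N2 (\<lambda>_. 1)" by (cases b) auto
  then show "satisfies_bc b p1 p2 N1 N2 (\<lambda>v\<in>sites p1 p2 N1 N2. 1)"
    by (simp only: satisfies_bc_restrict)
qed

lemma ln_bc_expectation:
  "ln (bc_expectation b p1 p2 N1 N2 (\<lambda>\<sigma>. exp (\<beta> * multiple_sum p1 p2 N1 N2 \<sigma>)))
    = ln (partition_sum N1 N2 \<beta> (satisfies_bc b p1 p2 N1 N2))
      - (real N1 * real N2 + real (card (chain_starts p1 p2 N1 N2))) * ln 2"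
  using partition_sum_bc_pos[of N1 N2 \<beta> b]
  by (simp add: bc_expectation_eq ln_div ln_realpow)

section \<open>Logarithms of the partition sums under the three boundary conditions\<close>

definition boundary :: "nat \<Rightarrow> nat \<Rightarrow> site set" where
  "boundary N1 N2 = {v \<in> box N1 N2. fst v \<in> {1, N1} \<or> snd v \<in> {1, N2}}"

lemma boundary_subset: "boundary N1 N2 \<subseteq> sites p1 p2 N1 N2"
  using box_subset_sites by (auto simp: boundary_def)

lemma card_boundary: "card (boundary N1 N2) \<le> 2 * (N1 + N2)"
proof -
  have two: "card {1, N} \<le> 2" for N :: nat by (cases "N = 1") auto
  have "card (boundary N1 N2) \<le> card ({1, N1} \<times> {1..N2} \<union> {1..N1} \<times> {1, N2})"
    by (rule card_mono) (auto simp: boundary_def box_def)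
  also have "\<dots> \<le> card ({1, N1} \<times> {1..N2}) + card ({1..N1} \<times> {1, N2})" by (rule card_Un_le)
  also have "\<dots> = card {1, N1} * N2 + N1 * card {1, N2}"
    by (simp only: card_cartesian_product card_atLeastAtMost diff_Suc_1 Suc_eq_plus1[symmetric])
  also have "\<dots> \<le> 2 * N2 + N1 * 2" by (intro add_mono mult_le_mono two order_refl)
  finally show ?thesis by simp
qed

text \<open>Pinning can only lower the sum. Conversely, at most \<open>2 * (N1 + N2)\<close> resets
  are needed, each costing \<open>ln 2 + 4 * \<bar>\<beta>\<bar>\<close> in the logarithm.\<close>

lemma ln_partition_sum_boundary:
  assumes P: "P (\<lambda>v\<in>sites p1 p2 N1 N2. 1)"
    and closed: "\<And>\<sigma> w. w \<in> boundary N1 N2 \<Longrightarrow> P \<sigma> \<Longrightarrow> P (\<sigma>(w := 1))"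
  shows "\<bar>ln (partition_sum N1 N2 \<beta> (\<lambda>\<sigma>. P \<sigma> \<and> (\<forall>w\<in>boundary N1 N2. \<sigma> w = 1)))
      - ln (partition_sum N1 N2 \<beta> P)\<bar> \<le> 2 * (real N1 + real N2) * (ln 2 + 4 * \<bar>\<beta>\<bar>)"
proof -
  let ?Z = "partition_sum N1 N2 \<beta> P"
  let ?Z' = "partition_sum N1 N2 \<beta> (\<lambda>\<sigma>. P \<sigma> \<and> (\<forall>w\<in>boundary N1 N2. \<sigma> w = 1))"
  let ?c = "2 * exp (4 * \<bar>\<beta>\<bar>)"
  have pos: "0 < ?Z" "0 < ?Z'"
    using P subsetD[OF boundary_subset] by (auto intro!: partition_sum_pos)
  have le: "?Z' \<le> ?Z" by (rule partition_sum_mono) simp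
  have "?Z \<le> ?c ^ card (boundary N1 N2) * ?Z'"
    using finite_subset[OF boundary_subset finite_sites] boundary_subset closed
    by (rule partition_sum_reset)
  then have "ln ?Z \<le> ln (?c ^ card (boundary N1 N2) * ?Z')"
    using pos by (subst ln_le_cancel_iff) auto
  also have "\<dots> = real (card (boundary N1 N2)) * (ln 2 + 4 * \<bar>\<beta>\<bar>) + ln ?Z'"
    using pos by (simp add: ln_mult ln_realpow distrib_left)
  also have "real (card (boundary N1 N2)) * (ln 2 + 4 * \<bar>\<beta>\<bar>)
      \<le> (2 * (real N1 + real N2)) * (ln 2 + 4 * \<bar>\<beta>\<bar>)"
    using of_nat_mono[OF card_boundary[of N1 N2], where 'a = real]
    by (intro mult_right_mono) auto
  finally show ?thesis using le pos by simp
qed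

lemma ln_partition_sum_BC1:
  "\<bar>ln (partition_sum N1 N2 \<beta> (satisfies_bc BC1 p1 p2 N1 N2))
      - (real N1 * real N2 * ln (exp \<beta> + exp (-\<beta>)) + real (card (chain_starts p1 p2 N1 N2)) * ln 2)\<bar>
    \<le> 2 * (real N1 + real N2) * (ln 2 + 4 * \<bar>\<beta>\<bar>)"
proof -
  have "satisfies_bc BC1 p1 p2 N1 N2 = (\<lambda>\<sigma>. True \<and> (\<forall>w\<in>boundary N1 N2. \<sigma> w = 1))"
    by (auto simp: boundary_def fun_eq_iff)
  moreover have "ln (partition_sum N1 N2 \<beta> (\<lambda>_. True))
      = real N1 * real N2 * ln (exp \<beta> + exp (-\<beta>)) + real (card (chain_starts p1 p2 N1 N2)) * ln 2"
    unfolding partition_sum_free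
    using add_pos_pos[OF exp_gt_zero exp_gt_zero, of \<beta> "-\<beta>"]
    by (simp add: ln_mult_pos ln_realpow)
  ultimately show ?thesis
    using ln_partition_sum_boundary[of "\<lambda>_. True" N1 N2 \<beta>] by simp
qed

text \<open>Failing to be strictly interior means being a chain end outside the box or a site of
  \<open>boundary\<close>. The latter lie in the box, so resetting them does not disturb the pinned
  ends.\<close>

lemma ln_partition_sum_BC2:
  "\<bar>ln (partition_sum N1 N2 \<beta> (satisfies_bc BC2 p1 p2 N1 N2))
      - real N1 * real N2 * ln (exp \<beta> + exp (-\<beta>))\<bar>
    \<le> 2 * (real N1 + real N2) * (ln 2 + 4 * \<bar>\<beta>\<bar>)"
proof -
  let ?P = "\<lambda>\<sigma>. \<forall>v\<in>sites p1 p2 N1 N2 - box N1 N2. \<sigma> v = (1 :: real)"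
  have "\<not> (1 < fst v \<and> fst v < N1 \<and> 1 < snd v \<and> snd v < N2)
      \<longleftrightarrow> v \<in> sites p1 p2 N1 N2 - box N1 N2 \<or> v \<in> boundary N1 N2"
    if "v \<in> sites p1 p2 N1 N2" for v
    using that sites_subset_lattice[of N1 N2]
    by (auto simp: boundary_def box_iff lattice_def)
  then have "satisfies_bc BC2 p1 p2 N1 N2 = (\<lambda>\<sigma>. ?P \<sigma> \<and> (\<forall>w\<in>boundary N1 N2. \<sigma> w = 1))"
    using boundary_subset[of N1 N2] by (auto simp: fun_eq_iff) blast+
  moreover have "ln (partition_sum N1 N2 \<beta> ?P) = real N1 * real N2 * ln (exp \<beta> + exp (-\<beta>))"
    unfolding partition_sum_ends by (simp add: ln_realpow add_pos_pos)
  ultimately show ?thesis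
    using ln_partition_sum_boundary[of ?P N1 N2 \<beta>] by (auto simp: boundary_def)
qed

text \<open>An exact identity: \<open>?a ^ l\<close> is factored out of
  \<open>?a ^ l + ?b ^ l\<close> for every chain, and the lengths of all chains add up to the size
  of the box.\<close>

lemma ln_partition_sum_BCp:
  "ln (partition_sum N1 N2 \<beta> (satisfies_bc BCp p1 p2 N1 N2))
    = real N1 * real N2 * ln (exp \<beta> + exp (-\<beta>))
      + (\<Sum>c\<in>chain_starts p1 p2 N1 N2. ln (1 + magnetization \<beta> ^ chain_length p1 p2 N1 N2 c))"
proof -
  let ?a = "exp \<beta> + exp (-\<beta>)" and ?b = "exp \<beta> - exp (-\<beta>)" and ?l = "chain_length p1 p2 N1 N2"
  let ?C = "chain_starts p1 p2 N1 N2"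
  have a: "?a > 0" by (simp add: add_pos_pos)
  have l: "?l c > 0" if "c \<in> ?C" for c
    using chain_site_box_iff[of c N1 N2 0] that by (simp add: chain_starts_eq)
  have t: "1 + magnetization \<beta> ^ ?l c > 0" if "c \<in> ?C" for c
  proof -
    have "\<bar>magnetization \<beta> ^ ?l c\<bar> < 1"
      using abs_magnetization l[OF that] by (simp add: power_abs power_less_one_iff)
    then show ?thesis by linarith
  qed
  have "?a ^ k + ?b ^ k = ?a ^ k * (1 + magnetization \<beta> ^ k)" for k
    using a by (simp add: magnetization_def power_divide field_simps)
  then have "partition_sum N1 N2 \<beta> (satisfies_bc BCp p1 p2 N1 N2)
      = (\<Prod>c\<in>?C. ?a ^ ?l c) * (\<Prod>c\<in>?C. 1 + magnetization \<beta> ^ ?l c)"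
    by (simp add: partition_sum_periodic prod.distrib)
  also have "(\<Prod>c\<in>?C. ?a ^ ?l c) = ?a ^ (N1 * N2)"
    using prod_box[of "\<lambda>_. ?a" N1 N2] by (simp add: card_box)
  finally have "partition_sum N1 N2 \<beta> (satisfies_bc BCp p1 p2 N1 N2)
      = ?a ^ (N1 * N2) * (\<Prod>c\<in>?C. 1 + magnetization \<beta> ^ ?l c)" .
  moreover have "0 < (\<Prod>c\<in>?C. 1 + magnetization \<beta> ^ ?l c)" using t by (intro prod_pos) auto
  moreover have "ln (\<Prod>c\<in>?C. 1 + magnetization \<beta> ^ ?l c) = (\<Sum>c\<in>?C. ln (1 + magnetization \<beta> ^ ?l c))"
    using t by (intro ln_prod) (simp_all add: less_imp_neq[symmetric])
  ultimately show ?thesis using a by (simp add: ln_mult_pos ln_realpow)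
qed

text \<open>A start still has its site number \<open>m\<close> in the box exactly when it is a start
  for the box with sides divided by the powers of the multipliers.\<close>

lemma card_longer_chains:
  "card {c \<in> chain_starts p1 p2 N1 N2. m < chain_length p1 p2 N1 N2 c}
    = (N1 div p1 ^ m) * (N2 div p2 ^ m) - (N1 div p1 ^ Suc m) * (N2 div p2 ^ Suc m)"
proof -
  have "v \<in> box N1 N2 \<and> chain_site p1 p2 v m \<in> box N1 N2
      \<longleftrightarrow> v \<in> box (N1 div p1 ^ m) (N2 div p2 ^ m)" for v
  proof -
    have "p1 ^ m \<ge> 1" "p2 ^ m \<ge> 1" using p1 p2 by auto
    moreover from this have "fst v \<le> fst v * p1 ^ m" "snd v \<le> snd v * p2 ^ m" by auto
    then have "fst v * p1 ^ m \<le> N1 \<Longrightarrow> fst v \<le> N1" "snd v * p2 ^ m \<le> N2 \<Longrightarrow> snd v \<le> N2"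
      by (blast intro: order_trans)+
    ultimately show ?thesis
      using p1 p2 unfolding box_iff chain_site_def
      by (auto simp: less_eq_div_iff_mult_less_eq Suc_le_eq)
  qed
  then have "c \<in> chain_starts p1 p2 N1 N2 \<and> m < chain_length p1 p2 N1 N2 c
      \<longleftrightarrow> c \<in> chain_starts p1 p2 (N1 div p1 ^ m) (N2 div p2 ^ m)" for c
    using chain_site_box_iff[of c N1 N2 m] by (simp add: chain_starts_def case_prod_unfold) blast
  then have "{c \<in> chain_starts p1 p2 N1 N2. m < chain_length p1 p2 N1 N2 c}
      = chain_starts p1 p2 (N1 div p1 ^ m) (N2 div p2 ^ m)" by blast
  then show ?thesis
    by (simp only: card_chain_starts div_mult2_eq[symmetric] power_Suc2)
qed

lemma div_power_mono:
  "(N1 div p1 ^ Suc m) * (N2 div p2 ^ Suc m) \<le> (N1 div p1 ^ m) * (N2 div p2 ^ m)"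
  using p1 p2 by (intro mult_le_mono div_le_mono2 power_increasing) auto

text \<open>Exact length is a difference of two counts of longer chains, each itself a difference;
  hence the second difference.\<close>

lemma card_chains_of_length:
  "real (card {c \<in> chain_starts p1 p2 N1 N2. chain_length p1 p2 N1 N2 c = Suc m})
    = real (N1 div p1 ^ m) * real (N2 div p2 ^ m)
      - 2 * (real (N1 div p1 ^ Suc m) * real (N2 div p2 ^ Suc m))
      + real (N1 div p1 ^ Suc (Suc m)) * real (N2 div p2 ^ Suc (Suc m))"
proof -
  let ?G = "\<lambda>m. {c \<in> chain_starts p1 p2 N1 N2. m < chain_length p1 p2 N1 N2 c}"
  have G: "real (card (?G m)) = real (N1 div p1 ^ m) * real (N2 div p2 ^ m)
      - real (N1 div p1 ^ Suc m) * real (N2 div p2 ^ Suc m)" for m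
    unfolding card_longer_chains by (simp only: of_nat_diff[OF div_power_mono] of_nat_mult)
  have "{c \<in> chain_starts p1 p2 N1 N2. chain_length p1 p2 N1 N2 c = Suc m} = ?G m - ?G (Suc m)"
    by auto
  moreover have "card (?G m - ?G (Suc m)) = card (?G m) - card (?G (Suc m))"
    by (rule card_Diff_subset) auto
  moreover have "card (?G (Suc m)) \<le> card (?G m)" by (rule card_mono) auto
  ultimately have "real (card {c \<in> chain_starts p1 p2 N1 N2. chain_length p1 p2 N1 N2 c = Suc m})
      = real (card (?G m)) - real (card (?G (Suc m)))" by (simp only: of_nat_diff)
  then show ?thesis unfolding G by simp
qed

text \<open>Grouping the chains by length and writing the finite sum as a series prepares the
  passage to the limit inside an infinite sum.\<close>

lemma chain_length_sums:
  fixes g :: "nat \<Rightarrow> real"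
  shows "(\<lambda>k. real (card {c \<in> chain_starts p1 p2 N1 N2. chain_length p1 p2 N1 N2 c = Suc k}) * g (Suc k))
    sums (\<Sum>c\<in>chain_starts p1 p2 N1 N2. g (chain_length p1 p2 N1 N2 c))"
proof -
  let ?C = "chain_starts p1 p2 N1 N2" and ?l = "chain_length p1 p2 N1 N2"
  let ?L = "(\<lambda>c. ?l c - 1) ` ?C"
  have l: "?l c = Suc (?l c - 1)" if "c \<in> ?C" for c
    using chain_site_box_iff[of c N1 N2 0] that by (simp add: chain_starts_eq)
  have eq: "{c. c \<in> ?C \<and> ?l c - 1 = k} = {c \<in> ?C. ?l c = Suc k}" for k
    using l by auto
  have "(\<Sum>c\<in>?C. g (?l c)) = (\<Sum>k\<in>?L. \<Sum>c | c \<in> ?C \<and> ?l c - 1 = k. g (?l c))"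
    by (rule sum.image_gen) simp
  also have "\<dots> = (\<Sum>k\<in>?L. real (card {c \<in> ?C. ?l c = Suc k}) * g (Suc k))"
    unfolding eq by (intro sum.cong) auto
  finally have sum_eq: "(\<Sum>c\<in>?C. g (?l c)) = (\<Sum>k\<in>?L. real (card {c \<in> ?C. ?l c = Suc k}) * g (Suc k))" .
  show ?thesis
    unfolding sum_eq
  proof (rule sums_finite)
    fix k assume "k \<notin> ?L"
    then have "{c \<in> ?C. ?l c = Suc k} = {}" by force
    then show "real (card {c \<in> ?C. ?l c = Suc k}) * g (Suc k) = 0" by simp
  qed simp
qed

subsection \<open>Limits of the energies\<close>

text \<open>The limiting number of chains with \<open>l\<close> bonds per box site: with P the
  product of the multipliers, it is the second difference
  \<open>(1 - 1 / P)\<^sup>2 / P ^ (l - 1)\<close> for \<open>l \<ge> 1\<close>.\<close>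

definition chain_density :: "nat \<Rightarrow> real" where
  "chain_density l = (real p1 * real p2 - 1)\<^sup>2 / (real p1 * real p2) ^ (l + 1)"

lemma p1p2_real: "2 \<le> real p1 * real p2"
  using of_nat_mono[OF p1p2, where 'a = real] by simp

lemma p1p2_nonzero: "real p1 \<noteq> 0" "real p2 \<noteq> 0"
  using p1 p2 by auto

lemma chain_density_bound: "\<bar>chain_density (Suc k)\<bar> \<le> 1"
proof -
  let ?P = "real p1 * real p2"
  have P: "2 \<le> ?P" by (rule p1p2_real)
  have "(?P - 1)\<^sup>2 \<le> ?P\<^sup>2" using P by (intro power_mono) auto
  also have "\<dots> \<le> ?P ^ (Suc k + 1)" using P by (intro power_increasing) auto
  finally show ?thesis using P by (simp add: chain_density_def)
qed

lemma tendsto_chain_density: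
  "((\<lambda>(N1, N2). real (card {c \<in> chain_starts p1 p2 N1 N2. chain_length p1 p2 N1 N2 c = Suc k})
      / (real N1 * real N2)) \<longlongrightarrow> chain_density (Suc k)) box_limit"
proof -
  let ?M = "\<lambda>m. \<lambda>(N1, N2). real (N1 div p1 ^ m) * real (N2 div p2 ^ m) / (real N1 * real N2)"
  let ?P = "real p1 * real p2"
  have lim: "(?M m \<longlongrightarrow> 1 / ?P ^ m) box_limit" for m
    using box_limit_div_ratio[of "p1 ^ m" "p2 ^ m"] p1 p2 by (simp add: power_mult_distrib)
  have "((\<lambda>N. ?M k N - 2 * ?M (Suc k) N + ?M (Suc (Suc k)) N)
      \<longlongrightarrow> 1 / ?P ^ k - 2 * (1 / ?P ^ Suc k) + 1 / ?P ^ Suc (Suc k)) box_limit"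
    by (intro tendsto_intros lim)
  moreover have "1 / ?P ^ k - 2 * (1 / ?P ^ Suc k) + 1 / ?P ^ Suc (Suc k) = chain_density (Suc k)"
  proof -
    have "Q \<noteq> 0 \<Longrightarrow> 1 / Q ^ k - 2 * (1 / Q ^ Suc k) + 1 / Q ^ Suc (Suc k) = (Q - 1)\<^sup>2 / Q ^ (Suc k + 1)"
      for Q :: real
      by (simp add: field_simps power2_eq_square)
    then show ?thesis using p1p2_nonzero by (simp add: chain_density_def)
  qed
  moreover have "?M k N - 2 * ?M (Suc k) N + ?M (Suc (Suc k)) N
      = (\<lambda>(N1, N2). real (card {c \<in> chain_starts p1 p2 N1 N2. chain_length p1 p2 N1 N2 c = Suc k})
      / (real N1 * real N2)) N" for N
    unfolding card_chains_of_length by (simp add: case_prod_unfold add_divide_distrib diff_divide_distrib)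
  ultimately show ?thesis by (simp only:)
qed

text \<open>A geometric bound independent of the box, which serves as the dominating sequence for
  the limit of the periodic series.\<close>

lemma chain_density_le:
  "real (card {c \<in> chain_starts p1 p2 N1 N2. chain_length p1 p2 N1 N2 c = Suc k})
      / (real N1 * real N2) \<le> 1 / (real p1 * real p2) ^ k"
proof -
  have "card {c \<in> chain_starts p1 p2 N1 N2. chain_length p1 p2 N1 N2 c = Suc k}
      \<le> card {c \<in> chain_starts p1 p2 N1 N2. k < chain_length p1 p2 N1 N2 c}"
    by (rule card_mono) auto
  also have "\<dots> \<le> (N1 div p1 ^ k) * (N2 div p2 ^ k)" unfolding card_longer_chains by simp
  finally have "real (card {c \<in> chain_starts p1 p2 N1 N2. chain_length p1 p2 N1 N2 c = Suc k})
      \<le> real (N1 div p1 ^ k) * real (N2 div p2 ^ k)" unfolding of_nat_mult[symmetric] by (rule of_nat_mono)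
  also have "\<dots> \<le> (real N1 / real (p1 ^ k)) * (real N2 / real (p2 ^ k))"
    by (rule mult_mono[OF of_nat_div_le_of_nat of_nat_div_le_of_nat]) simp_all
  also have "\<dots> = (real N1 * real N2) * (1 / (real p1 * real p2) ^ k)"
    by (simp add: power_mult_distrib)
  finally have "real (card {c \<in> chain_starts p1 p2 N1 N2. chain_length p1 p2 N1 N2 c = Suc k})
      \<le> (real N1 * real N2) * (1 / (real p1 * real p2) ^ k)" .
  then show ?thesis
    by (cases "real N1 * real N2 = 0") (auto simp: divide_le_eq mult.commute zero_less_mult_iff)
qed

text \<open>Tannery's theorem exchanges the limit over boxes with the sum over lengths: densities
  are dominated geometrically, and the logarithms by the constant \<open>A\<close>, as \<bar>t\<bar>
  < 1.\<close>

lemma periodic_sum_limit: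
  "summable (\<lambda>k. chain_density (Suc k) * ln (1 + magnetization \<beta> ^ Suc k)) \<and>
   ((\<lambda>(N1, N2). (\<Sum>c\<in>chain_starts p1 p2 N1 N2. ln (1 + magnetization \<beta> ^ chain_length p1 p2 N1 N2 c))
      / (real N1 * real N2))
    \<longlongrightarrow> (\<Sum>k. chain_density (Suc k) * ln (1 + magnetization \<beta> ^ Suc k))) box_limit"
proof -
  define t where "t = magnetization \<beta>"
  define g where "g k = ln (1 + t ^ k)" for k
  define A where "A = - ln (1 - \<bar>t\<bar>)"
  have t: "\<bar>t\<bar> < 1" unfolding t_def by (rule abs_magnetization)
  have g: "\<bar>g (Suc k)\<bar> \<le> A" for k
  proof -
    have "\<bar>t ^ Suc k\<bar> \<le> \<bar>t\<bar>" using power_decreasing[of 1 "Suc k" "\<bar>t\<bar>"] t by (simp add: power_abs abs_mult)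
    then show ?thesis unfolding g_def A_def using t by (rule abs_ln_one_plus_le)
  qed
  define n where "n = (\<lambda>k (N1, N2). real (card {c \<in> chain_starts p1 p2 N1 N2.
      chain_length p1 p2 N1 N2 c = Suc k}) / (real N1 * real N2))"
  have n: "0 \<le> n k N" "n k N \<le> 1 / (real p1 * real p2) ^ k" for k N
    using chain_density_le by (auto simp: n_def case_prod_unfold)
  have tannery: "(\<forall>\<^sub>F N in box_limit. summable (\<lambda>k. norm (n k N * g (Suc k)))) \<and>
      summable (\<lambda>k. norm (chain_density (Suc k) * g (Suc k))) \<and>
      ((\<lambda>N. \<Sum>k. n k N * g (Suc k)) \<longlongrightarrow> (\<Sum>k. chain_density (Suc k) * g (Suc k))) box_limit"
  proof (rule tannerys_theorem[where M = "\<lambda>k. (1 / (real p1 * real p2)) ^ k * A"])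
    show "((\<lambda>N. n k N * g (Suc k)) \<longlongrightarrow> chain_density (Suc k) * g (Suc k)) box_limit" for k
      unfolding n_def by (intro tendsto_mult_right tendsto_chain_density)
    show "\<forall>\<^sub>F (k, N) in at_top \<times>\<^sub>F box_limit. norm (n k N * g (Suc k)) \<le> (1 / (real p1 * real p2)) ^ k * A"
    proof (rule always_eventually, safe)
      fix k N1 N2
      have "norm (n k (N1, N2) * g (Suc k)) = n k (N1, N2) * \<bar>g (Suc k)\<bar>"
        using n(1) by (simp add: abs_mult)
      also have "\<dots> \<le> (1 / (real p1 * real p2) ^ k) * A"
        using n g by (intro mult_mono) auto
      finally show "norm (n k (N1, N2) * g (Suc k)) \<le> (1 / (real p1 * real p2)) ^ k * A"
        by (simp add: power_one_over)
    qed
    show "summable (\<lambda>k. (1 / (real p1 * real p2)) ^ k * A)"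
      using p1p2_real by (intro summable_mult2 summable_geometric) auto
  qed (rule box_limit_neq_bot)
  have eq: "(\<Sum>k. n k N * g (Suc k)) =
      (\<lambda>(N1, N2). (\<Sum>c\<in>chain_starts p1 p2 N1 N2. g (chain_length p1 p2 N1 N2 c)) / (real N1 * real N2)) N"
    for N
  proof -
    obtain N1 N2 where N: "N = (N1, N2)" by fastforce
    show ?thesis
      using sums_unique[OF sums_divide[OF chain_length_sums[of N1 N2 g]], symmetric]
      by (simp add: N n_def)
  qed
  have "summable (\<lambda>k. chain_density (Suc k) * g (Suc k))"
    by (rule summable_norm_cancel[OF conjunct1[OF conjunct2[OF tannery]]])
  moreover have "((\<lambda>(N1, N2). (\<Sum>c\<in>chain_starts p1 p2 N1 N2. g (chain_length p1 p2 N1 N2 c))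
      / (real N1 * real N2)) \<longlongrightarrow> (\<Sum>k. chain_density (Suc k) * g (Suc k))) box_limit"
    using conjunct2[OF conjunct2[OF tannery]] unfolding eq by (simp only: case_prod_eta)
  ultimately show ?thesis unfolding g_def t_def by (rule conjI)
qed

lemma tendsto_chain_starts:
  "((\<lambda>(N1, N2). real (card (chain_starts p1 p2 N1 N2)) / (real N1 * real N2))
    \<longlongrightarrow> 1 - 1 / (real p1 * real p2)) box_limit"
proof -
  have "((\<lambda>N. 1 - (\<lambda>(N1, N2). real (N1 div p1) * real (N2 div p2) / (real N1 * real N2)) N)
      \<longlongrightarrow> 1 - 1 / (real p1 * real p2)) box_limit"
    using p1 p2 by (intro tendsto_intros box_limit_div_ratio)
  moreover have "\<forall>\<^sub>F N in box_limit.
      1 - (\<lambda>(N1, N2). real (N1 div p1) * real (N2 div p2) / (real N1 * real N2)) N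
      = (\<lambda>(N1, N2). real (card (chain_starts p1 p2 N1 N2)) / (real N1 * real N2)) N"
    using eventually_box_limit_pos
  proof eventually_elim
    case (elim N)
    obtain N1 N2 where N: "N = (N1, N2)" by fastforce
    have "(N1 div p1) * (N2 div p2) \<le> N1 * N2" by (intro mult_le_mono div_le_dividend)
    then have "real (card (chain_starts p1 p2 N1 N2)) = real N1 * real N2 - real (N1 div p1) * real (N2 div p2)"
      by (simp add: card_chain_starts of_nat_diff)
    then show ?case using elim by (simp add: N diff_divide_distrib)
  qed
  ultimately show ?thesis by (rule Lim_transform_eventually)
qed

lemma finite_energy_eq:
  "finite_energy b p1 p2 \<beta> (N1, N2) =
    (ln (partition_sum N1 N2 \<beta> (satisfies_bc b p1 p2 N1 N2))
      - (real N1 * real N2 + real (card (chain_starts p1 p2 N1 N2))) * ln 2) / (real N1 * real N2)"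
  by (simp add: finite_energy_def ln_bc_expectation)

text \<open>Here \<open>a\<close> is the contribution of a bond and \<open>m\<close> that of a chain
  end: \<open>ln 2\<close> when it is free, 0 when it is pinned. The normalisation subtracts ln 2
  from both, and \<open>c\<close> measures the boundary error.\<close>

lemma tendsto_up_to_boundary:
  fixes Z :: "nat \<Rightarrow> nat \<Rightarrow> real"
  assumes Z: "\<And>N1 N2. \<bar>ln (Z N1 N2) - (real N1 * real N2 * a + m * real (card (chain_starts p1 p2 N1 N2)))\<bar>
      \<le> 2 * (real N1 + real N2) * c"
    and L: "L = a - ln 2 + (m - ln 2) * (1 - 1 / (real p1 * real p2))"
  shows "((\<lambda>(N1, N2). (ln (Z N1 N2) - (real N1 * real N2 + real (card (chain_starts p1 p2 N1 N2))) * ln 2)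
      / (real N1 * real N2)) \<longlongrightarrow> L) box_limit"
proof -
  let ?d = "\<lambda>(N1, N2). real (card (chain_starts p1 p2 N1 N2)) / (real N1 * real N2)"
  let ?E = "\<lambda>(N1, N2). (ln (Z N1 N2) - (real N1 * real N2 * a + m * real (card (chain_starts p1 p2 N1 N2))))
      / (real N1 * real N2)"
  have "(?E \<longlongrightarrow> 0) box_limit"
    using Z
    by (intro Lim_null_comparison[OF _ box_limit_boundary_ratio[of c]] always_eventually)
      (auto simp: abs_divide intro!: divide_right_mono)
  then have "((\<lambda>N. ?E N + (a - ln 2) + (m - ln 2) * ?d N)
      \<longlongrightarrow> 0 + (a - ln 2) + (m - ln 2) * (1 - 1 / (real p1 * real p2))) box_limit"
    by (intro tendsto_intros tendsto_chain_starts)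
  moreover have "\<forall>\<^sub>F N in box_limit. ?E N + (a - ln 2) + (m - ln 2) * ?d N =
      (\<lambda>(N1, N2). (ln (Z N1 N2) - (real N1 * real N2 + real (card (chain_starts p1 p2 N1 N2))) * ln 2)
      / (real N1 * real N2)) N"
    using eventually_box_limit_pos
    by eventually_elim (auto simp: case_prod_unfold field_simps)
  ultimately show ?thesis unfolding L by (simp add: Lim_transform_eventually)
qed

lemma finite_energy_tendsto:
  "(finite_energy b p1 p2 \<beta> \<longlongrightarrow> explicit_energy b p1 p2 \<beta>) box_limit"
proof -
  let ?a = "ln (exp \<beta> + exp (-\<beta>))"
  have eq: "finite_energy b p1 p2 \<beta> = (\<lambda>(N1, N2).
      (ln (partition_sum N1 N2 \<beta> (satisfies_bc b p1 p2 N1 N2))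
      - (real N1 * real N2 + real (card (chain_starts p1 p2 N1 N2))) * ln 2) / (real N1 * real N2))"
    by (auto simp: finite_energy_eq)
  have L: "?a - (2 * real p1 * real p2 - 1) / (real p1 * real p2) * ln 2
      = ?a - ln 2 + (0 - ln 2) * (1 - 1 / (real p1 * real p2))"
    using p1p2_nonzero by (simp add: field_simps)
  show ?thesis
  proof (cases b)
    case BC1
    show ?thesis unfolding eq unfolding BC1
      by (rule tendsto_up_to_boundary[where a = ?a and m = "ln 2" and c = "ln 2 + 4 * \<bar>\<beta>\<bar>"])
        (use ln_partition_sum_BC1[where \<beta> = \<beta>] in \<open>simp_all add: mult_ac\<close>)
  next
    case BC2
    show ?thesis unfolding eq unfolding BC2
      by (rule tendsto_up_to_boundary[where a = ?a and m = 0 and c = "ln 2 + 4 * \<bar>\<beta>\<bar>"])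
        (use ln_partition_sum_BC2[where \<beta> = \<beta>] L in simp_all)
  next
    case BCp
    let ?s = "\<lambda>(N1, N2). (\<Sum>c\<in>chain_starts p1 p2 N1 N2.
        ln (1 + magnetization \<beta> ^ chain_length p1 p2 N1 N2 c)) / (real N1 * real N2)"
    \<comment> \<open>The bond part is treated as a fictitious partition sum
      \<open>exp (real N1 * real N2 * ?a)\<close> with no boundary error, which reuses the limit for
      pinned ends; the correction for periodicity is added separately.\<close>
    have "((\<lambda>N. (\<lambda>(N1, N2). (ln (exp (real N1 * real N2 * ?a))
        - (real N1 * real N2 + real (card (chain_starts p1 p2 N1 N2))) * ln 2) / (real N1 * real N2)) N + ?s N)
      \<longlongrightarrow> (?a - (2 * real p1 * real p2 - 1) / (real p1 * real p2) * ln 2)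
        + (\<Sum>k. chain_density (Suc k) * ln (1 + magnetization \<beta> ^ Suc k))) box_limit"
    proof (rule tendsto_add)
      show "((\<lambda>(N1, N2). (ln (exp (real N1 * real N2 * ?a))
          - (real N1 * real N2 + real (card (chain_starts p1 p2 N1 N2))) * ln 2) / (real N1 * real N2))
        \<longlongrightarrow> ?a - (2 * real p1 * real p2 - 1) / (real p1 * real p2) * ln 2) box_limit"
        by (rule tendsto_up_to_boundary[where a = ?a and m = 0 and c = 0]) (use L in simp_all)
    qed (use periodic_sum_limit in blast)
    then show ?thesis unfolding eq unfolding BCp
      by (simp add: ln_partition_sum_BCp case_prod_unfold chain_density_def
          add_divide_distrib diff_divide_distrib algebra_simps)
  qed
qed

lemma explicit_energy_differentiable: "explicit_energy b p1 p2 differentiable (at \<beta>)"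
proof -
  have pos: "exp \<beta> + exp (-\<beta>) > 0" for \<beta> :: real by (simp add: add_pos_pos)
  obtain d where d: "((\<lambda>\<beta>. ln (exp \<beta> + exp (-\<beta>))) has_real_derivative d) (at \<beta>)"
    using pos[of \<beta>] by (auto intro!: that derivative_eq_intros)
  obtain m where m: "(magnetization has_real_derivative m) (at \<beta>)"
    using magnetization_has_derivative by blast
  let ?\<Phi> = "\<lambda>x. \<Sum>k. chain_density (Suc k) * ln (1 + x ^ Suc k)"
  have "?\<Phi> differentiable (at (magnetization \<beta>))"
    by (rule ln_one_plus_power_series_differentiable[OF chain_density_bound abs_magnetization])
  then obtain D where "(?\<Phi> has_real_derivative D) (at (magnetization \<beta>))"
    by (auto simp: real_differentiable_def)
  from DERIV_chain2[OF this m]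
  have s: "((\<lambda>\<beta>. ?\<Phi> (magnetization \<beta>)) has_real_derivative D * m) (at \<beta>)" .
  have "\<exists>e. (explicit_energy b p1 p2 has_real_derivative e) (at \<beta>)"
  proof (cases b)
    case BC1
    then have "explicit_energy b p1 p2 = (\<lambda>\<beta>. ln (exp \<beta> + exp (-\<beta>)) - ln 2)" by auto
    then show ?thesis using DERIV_diff[OF d DERIV_const] by (intro exI) (simp only:)
  next
    case BC2
    then have "explicit_energy b p1 p2 = (\<lambda>\<beta>. ln (exp \<beta> + exp (-\<beta>))
        - (2 * real p1 * real p2 - 1) / (real p1 * real p2) * ln 2)" by auto
    then show ?thesis using DERIV_diff[OF d DERIV_const] by (intro exI) (simp only:)
  next
    case BCp
    then have "explicit_energy b p1 p2 = (\<lambda>\<beta>. ln (exp \<beta> + exp (-\<beta>))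
        - (2 * real p1 * real p2 - 1) / (real p1 * real p2) * ln 2 + ?\<Phi> (magnetization \<beta>))"
      by (simp add: fun_eq_iff chain_density_def)
    then show ?thesis
      using DERIV_add[OF DERIV_diff[OF d DERIV_const] s] by (intro exI) (simp only:)
  qed
  then show ?thesis by (simp add: real_differentiable_def)
qed

subsection \<open>Laws of the multiple average\<close>

lemma measurable_multiple_sum [measurable]:
  "multiple_sum p1 p2 N1 N2 \<in> borel_measurable spin_measure"
proof -
  have "(\<lambda>\<sigma>. \<Sum>v\<in>box N1 N2. \<sigma> v * \<sigma> (next_site v)) \<in> borel_measurable spin_measure"
  proof (intro borel_measurable_sum borel_measurable_times measurable_spin)
    fix v assume "v \<in> box N1 N2"
    then show "v \<in> lattice" "next_site v \<in> lattice"
      using box_subset_sites next_site_sites sites_subset_lattice by blast+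
  qed
  then show ?thesis by (simp add: multiple_sum_eq[abs_def])
qed

lemma sets_bc_event [measurable]: "bc_event b p1 p2 N1 N2 \<in> sets spin_measure"
proof -
  have sites: "v \<in> lattice" if "v \<in> sites p1 p2 N1 N2" for v
    using that sites_subset_lattice by blast
  have all_one: "{\<sigma> \<in> space spin_measure. \<forall>v\<in>A. \<sigma> v = 1} \<in> sets spin_measure"
    if "A \<subseteq> sites p1 p2 N1 N2" for A
    using that finite_subset[OF that] sites
    by (intro sets.sets_Collect_finite_All borel_measurable_eq measurable_spin) auto
  show ?thesis
  proof (cases b)
    case BC1
    have "bc_event b p1 p2 N1 N2 = {\<sigma> \<in> space spin_measure. \<forall>v\<in>boundary N1 N2. \<sigma> v = 1}"
      by (auto simp: BC1 bc_event_def boundary_def)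
    then show ?thesis using all_one[OF boundary_subset] by simp
  next
    case BC2
    let ?A = "{v \<in> sites p1 p2 N1 N2. \<not> (1 < fst v \<and> fst v < N1 \<and> 1 < snd v \<and> snd v < N2)}"
    have eq: "bc_event b p1 p2 N1 N2 = {\<sigma> \<in> space spin_measure. \<forall>v\<in>?A. \<sigma> v = 1}"
      unfolding BC2 bc_event_def by fastforce
    show ?thesis unfolding eq by (rule all_one) blast
  next
    case BCp
    have "{\<sigma> \<in> space spin_measure. \<forall>c\<in>chain_starts p1 p2 N1 N2.
        \<sigma> c = \<sigma> (chain_site p1 p2 c (chain_length p1 p2 N1 N2 c))} \<in> sets spin_measure"
    proof (intro sets.sets_Collect_finite_All borel_measurable_eq measurable_spin sites)
      fix c assume "c \<in> chain_starts p1 p2 N1 N2"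
      then have "c \<in> box N1 N2" by (simp add: chain_starts_eq)
      then show "c \<in> sites p1 p2 N1 N2"
          "chain_site p1 p2 c (chain_length p1 p2 N1 N2 c) \<in> sites p1 p2 N1 N2"
        using box_subset_sites chain_end_sites by blast+
    qed simp
    then show ?thesis by (simp add: BCp bc_event_def)
  qed
qed

lemma space_bc_measure [simp]: "space (bc_measure b p1 p2 N1 N2) = space spin_measure"
  and sets_bc_measure [measurable_cong]: "sets (bc_measure b p1 p2 N1 N2) = sets spin_measure"
  by (simp_all add: bc_measure_def)

lemma measurable_average:
  "(\<lambda>\<sigma>. multiple_sum p1 p2 N1 N2 \<sigma> / (real N1 * real N2)) \<in> borel_measurable (bc_measure b p1 p2 N1 N2)"
  by measurable

lemma emeasure_bc_measure:
  "emeasure (bc_measure b p1 p2 N1 N2) (space spin_measure) \<le> 1"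
proof -
  interpret prob_space spin_measure by (rule prob_space_spin_measure)
  show ?thesis
    unfolding bc_measure_def by (subst emeasure_restricted) (auto simp: emeasure_le_1)
qed

lemma emeasure_multiple_average_law:
  "emeasure (multiple_average_law b p1 p2 N) (space (multiple_average_law b p1 p2 N)) \<le> 1"
proof -
  obtain N1 N2 where N: "N = (N1, N2)" by fastforce
  show ?thesis
    using emeasure_bc_measure[of b N1 N2]
    by (simp add: N multiple_average_law_def emeasure_distr[OF measurable_average])
qed

lemma finite_multiple_average_law: "finite_measure (multiple_average_law b p1 p2 N)"
  using emeasure_multiple_average_law[of b N]
  by (intro finite_measureI) (auto simp: top_unique)

lemma abs_multiple_sum_le:
  assumes "\<sigma> \<in> space spin_measure"
  shows "\<bar>multiple_sum p1 p2 N1 N2 \<sigma>\<bar> \<le> real N1 * real N2"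
proof -
  have "\<bar>\<sigma> v * \<sigma> (next_site v)\<bar> \<le> 1" if v: "v \<in> box N1 N2" for v
  proof -
    have "v \<in> lattice" "next_site v \<in> lattice"
      using v box_subset_sites next_site_sites sites_subset_lattice by blast+
    then have "\<sigma> v \<in> {1, -1}" "\<sigma> (next_site v) \<in> {1, -1}"
      using assms by (auto simp: space_spin_measure dest: PiE_mem)
    then show ?thesis by auto
  qed
  then have "\<bar>multiple_sum p1 p2 N1 N2 \<sigma>\<bar> \<le> (\<Sum>v\<in>box N1 N2. 1)"
    unfolding multiple_sum_eq by (intro order_trans[OF sum_abs] sum_mono)
  then show ?thesis by (simp add: card_box)
qed

lemma AE_multiple_average_law: "AE x in multiple_average_law b p1 p2 N. \<bar>x\<bar> \<le> 1"
proof -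
  obtain N1 N2 where N: "N = (N1, N2)" by fastforce
  have "AE \<sigma> in bc_measure b p1 p2 N1 N2. \<bar>multiple_sum p1 p2 N1 N2 \<sigma> / (real N1 * real N2)\<bar> \<le> 1"
  proof (rule AE_I2)
    fix \<sigma> assume "\<sigma> \<in> space (bc_measure b p1 p2 N1 N2)"
    then have "\<bar>multiple_sum p1 p2 N1 N2 \<sigma>\<bar> \<le> real N1 * real N2"
      by (intro abs_multiple_sum_le) simp
    then show "\<bar>multiple_sum p1 p2 N1 N2 \<sigma> / (real N1 * real N2)\<bar> \<le> 1"
      by (cases "real N1 * real N2 = 0") (auto simp: abs_divide divide_le_eq_1 abs_mult)
  qed
  then show ?thesis
    unfolding N multiple_average_law_def split
    by (subst AE_distr_iff[OF measurable_average]) measurable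
qed

lemma mgf_multiple_average_law:
  "(\<integral>x. exp (\<beta> * (real N1 * real N2) * x) \<partial>multiple_average_law b p1 p2 (N1, N2))
    = bc_expectation b p1 p2 N1 N2 (\<lambda>\<sigma>. exp (\<beta> * multiple_sum p1 p2 N1 N2 \<sigma>))"
proof -
  let ?B = "bc_event b p1 p2 N1 N2"
  let ?S = "multiple_sum p1 p2 N1 N2"
  have "(\<integral>x. exp (\<beta> * (real N1 * real N2) * x) \<partial>multiple_average_law b p1 p2 (N1, N2))
      = (\<integral>\<sigma>. exp (\<beta> * (real N1 * real N2) * (?S \<sigma> / (real N1 * real N2))) \<partial>bc_measure b p1 p2 N1 N2)"
    by (simp add: multiple_average_law_def integral_distr[OF measurable_average])
  \<comment> \<open>For an empty box the quotient is 0 by the convention on division, and the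
    multiple sum is 0 as well, so the volume cancels for all boxes.\<close>
  also have "\<dots> = (\<integral>\<sigma>. exp (\<beta> * ?S \<sigma>) \<partial>bc_measure b p1 p2 N1 N2)"
  proof (intro Bochner_Integration.integral_cong refl)
    fix \<sigma> assume "\<sigma> \<in> space (bc_measure b p1 p2 N1 N2)"
    then have "\<bar>?S \<sigma>\<bar> \<le> real N1 * real N2" by (intro abs_multiple_sum_le) simp
    then show "exp (\<beta> * (real N1 * real N2) * (?S \<sigma> / (real N1 * real N2))) = exp (\<beta> * ?S \<sigma>)"
      by (cases "real N1 * real N2 = 0") auto
  qed
  also have "bc_measure b p1 p2 N1 N2 = density spin_measure (\<lambda>\<sigma>. ennreal (indicator ?B \<sigma>))"
    by (simp add: bc_measure_def ennreal_indicator)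
  also have "(\<integral>\<sigma>. exp (\<beta> * ?S \<sigma>) \<partial>density spin_measure (\<lambda>\<sigma>. ennreal (indicator ?B \<sigma>)))
      = (\<integral>\<sigma>. indicator ?B \<sigma> *\<^sub>R exp (\<beta> * ?S \<sigma>) \<partial>spin_measure)"
    by (rule integral_density) auto
  finally show ?thesis by (simp add: bc_expectation_def mult.commute)
qed

lemma exponential_laws_multiple_average:
  "exponential_laws box_limit (\<lambda>(N1, N2). real N1 * real N2) (multiple_average_law b p1 p2)
     (explicit_energy b p1 p2) 1"
proof (rule exponential_laws.intro)
  let ?s = "\<lambda>(N1, N2). real N1 * real N2"
  have mgf: "(\<integral>x. exp (\<beta> * ?s N * x) \<partial>multiple_average_law b p1 p2 N)
      = bc_expectation b p1 p2 (fst N) (snd N) (\<lambda>\<sigma>. exp (\<beta> * multiple_sum p1 p2 (fst N) (snd N) \<sigma>))"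
    for \<beta> N
    using mgf_multiple_average_law[where ?N1.0 = "fst N" and ?N2.0 = "snd N" and b = b and \<beta> = \<beta>] by (simp add: case_prod_unfold)
  show "box_limit \<noteq> bot" by (rule box_limit_neq_bot)
  show "filterlim ?s at_top box_limit" by (rule filterlim_box_volume)
  show "sets (multiple_average_law b p1 p2 N) = sets borel" for N
    by (simp add: multiple_average_law_def case_prod_unfold)
  show "finite_measure (multiple_average_law b p1 p2 N)" for N
    by (rule finite_multiple_average_law)
  show "measure (multiple_average_law b p1 p2 N) (space (multiple_average_law b p1 p2 N)) \<le> 1" for N
    using enn2real_mono[OF emeasure_multiple_average_law[of b N]] by (simp add: measure_def)
  show "AE x in multiple_average_law b p1 p2 N. \<bar>x\<bar> \<le> 1" for N
    by (rule AE_multiple_average_law)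
  show "\<forall>\<^sub>F N in box_limit. 0 < (\<integral>x. exp (\<beta> * ?s N * x) \<partial>multiple_average_law b p1 p2 N)" for \<beta>
    unfolding mgf by (intro always_eventually allI) (simp add: bc_expectation_eq partition_sum_bc_pos)
  show "((\<lambda>N. ln (\<integral>x. exp (\<beta> * ?s N * x) \<partial>multiple_average_law b p1 p2 N) / ?s N)
      \<longlongrightarrow> explicit_energy b p1 p2 \<beta>) box_limit" for \<beta>
    using finite_energy_tendsto[of b \<beta>]
    unfolding mgf finite_energy_def by (simp add: case_prod_unfold)
  show "explicit_energy b p1 p2 differentiable (at \<beta>)" for \<beta>
    by (rule explicit_energy_differentiable)
qed

lemma energy_function_eq: "energy_function b p1 p2 = explicit_energy b p1 p2"
proof
  fix \<beta> show "energy_function b p1 p2 \<beta> = explicit_energy b p1 p2 \<beta>"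
    unfolding energy_function_def
    by (rule tendsto_Lim[OF box_limit_neq_bot finite_energy_tendsto])
qed

lemma summable_periodic:
  "summable (\<lambda>k. (real p1 * real p2 - 1)\<^sup>2 / (real p1 * real p2) ^ (Suc k + 1)
    * ln (1 + magnetization \<beta> ^ Suc k))"
  using periodic_sum_limit[of \<beta>] unfolding chain_density_def by (rule conjunct1)

end

theorem theorem5p1:
  fixes p1 p2 :: nat
  assumes "p1 \<ge> 1" and "p2 \<ge> 1" and "coprime p1 p2" and "p1 * p2 \<ge> 2"
  shows
    "(\<forall>b \<beta>. (finite_energy b p1 p2 \<beta> \<longlongrightarrow> energy_function b p1 p2 \<beta>) box_limit)
     \<and> (\<forall>\<beta>. energy_function BC1 p1 p2 \<beta> = ln (exp \<beta> + exp (-\<beta>)) - ln 2)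
     \<and> (\<forall>\<beta>. energy_function BC2 p1 p2 \<beta> =
            ln (exp \<beta> + exp (-\<beta>)) - (2 * real p1 * real p2 - 1) / (real p1 * real p2) * ln 2)
     \<and> (\<forall>\<beta>.
          summable (\<lambda>k. let l = Suc k in
            (real p1 * real p2 - 1)\<^sup>2 / (real p1 * real p2) ^ (l + 1) *
            ln (1 + ((exp \<beta> - exp (-\<beta>)) / (exp \<beta> + exp (-\<beta>))) ^ l))
          \<and> energy_function BCp p1 p2 \<beta> =
            ln (exp \<beta> + exp (-\<beta>)) - (2 * real p1 * real p2 - 1) / (real p1 * real p2) * ln 2
            + (\<Sum>k. let l = Suc k in
                (real p1 * real p2 - 1)\<^sup>2 / (real p1 * real p2) ^ (l + 1) *
                ln (1 + ((exp \<beta> - exp (-\<beta>)) / (exp \<beta> + exp (-\<beta>))) ^ l)))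
     \<and> (\<forall>b \<beta>. energy_function b p1 p2 differentiable (at \<beta>))
     \<and> (\<forall>b. large_deviation_principle box_limit (\<lambda>(N1, N2). real N1 * real N2)
            (multiple_average_law b p1 p2) (legendre_transform (energy_function b p1 p2)))
     \<and> (\<forall>b \<eta> y. (energy_function b p1 p2 has_real_derivative y) (at \<eta>) \<longrightarrow>
            legendre_transform (energy_function b p1 p2) y
              = ereal (\<eta> * y - energy_function b p1 p2 \<eta>))"
proof -
  interpret chains p1 p2 using assms by unfold_locales
  note laws = exponential_laws_multiple_average
  show ?thesis
    unfolding energy_function_eq Let_def explicit_energy.simps magnetization_def[symmetric]
    using finite_energy_tendsto summable_periodic explicit_energy_differentiable
      exponential_laws.large_deviations[OF laws] exponential_laws.legendre_at_derivative[OF laws]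
    by (intro conjI allI impI refl)
qed

end
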